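(* Let $r,d\in\mathbb{N}$, let $B\in\mathbb{R}^{d\times d}$ be a Frolov matrix, and let $U$ and $V$ be independent random vectors uniformly distributed in $[1,2^{1/d}]^d$ and $[0,1]^d$, respectively. There is some $c>0$ (which may depend on $r$, $d$ and $B$) such that for every natural number $n\geq 2$ and every $f\in \mathring{H}^{r,\mathrm{mix}}([0,1]^d)$ \[ \left(\mathbb{E}\left|Q_{n^{1/d}\hat{U}B}^V(f)-I_d(f)\right|^2\right)^{1/2} \leq c\, n^{-r-1/2}\, \Vert f\Vert_{H^{r,\mathrm{mix}}([0,1]^d)}. \]
   Context: Notation: $\mathbb{N}=\{1,2,\dots\}$ and $I_d(f)=\int_{\mathbb{R}^d} f(x)\,dx$. For an invertible matrix $S\in\mathbb{R}^{d\times d}$ and $v\in\mathbb{R}^d$, the quadrature rule $Q_S^v$ is \[Q_S^v(f)=\frac{1}{|\det S|}\sum_{m\in\mathbb{Z}^d} f\left(S^{-\top}(m+v)\right),\] where $S^{-\top}$ is the transpose of the inverse of $S$. For $u\in\mathbb{R}^d$, $\hat{u}=\mathrm{diag}(u_1,\dots,u_d)$; thus $\hat U$ is the random diagonal matrix with diagonal $U$. The expectation is with respect to $(U,V)$. A matrix $B\in\mathbb{R}^{d\times d}$ is a Frolov matrix if: (a) $B$ is invertible; (b) $\left|\prod_{j=1}^d (Bm)_j\right|\geq 1$ for every $m\in\mathbb{Z}^d\setminus\{0\}$; (c) for all $x,y\in\mathbb{R}^d$ the box $[x,y]=\{z\in\mathbb{R}^d : z_j \text{ lies between } x_j \text{ and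 } y_j \text{ (inclusive) for } j=1,\dots,d\}$ with volume $V_0=\prod_{j=1}^d|x_j-y_j|$ contains at most $V_0+1$ lattice points $Bm$, $m\in\mathbb{Z}^d$. $H^{r,\mathrm{mix}}(\mathbb{R}^d)$ is the space of real-valued $f\in L^2(\mathbb{R}^d)$ whose weak derivatives $D^\alpha f$ exist and lie in $L^2(\mathbb{R}^d)$ for all $\alpha\in\{0,\dots,r\}^d$; its elements are identified with their continuous representatives. $\mathring{H}^{r,\mathrm{mix}}([0,1]^d)$ is the subspace of those $f$ with support in $[0,1]^d$. The norm is $\Vert f\Vert_{H^{r,\mathrm{mix}}([0,1]^d)}=\left(\sum_{\alpha\in\{0,\dots,r\}^d}\Vert D^\alpha f\Vert_{L^2([0,1]^d)}^2\right)^{1/2}$. *)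

theory Defs
  imports "HOL-Probability.Probability"
begin

definition of_int_vec :: "int ^ 'd \<Rightarrow> real ^ 'd" where
  "of_int_vec m = (\<chi> i. real_of_int (m $ i))"

definition diag_mat :: "real ^ 'd \<Rightarrow> real ^ 'd ^ 'd" where
  "diag_mat u = (\<chi> i j. if i = j then u $ i else 0)"

text \<open>The corners of the box are not ordered, so \<open>cbox x y\<close> would be the wrong set.\<close>

definition corner_box :: "real ^ 'd \<Rightarrow> real ^ 'd \<Rightarrow> (real ^ 'd) set" where
  "corner_box x y = {z. \<forall>j. min (x $ j) (y $ j) \<le> z $ j \<and> z $ j \<le> max (x $ j) (y $ j)}"

text \<open>Finiteness is explicit because \<open>card\<close> of an infinite set is 0.\<close>

definition frolov_matrix :: "real ^ 'd ^ 'd \<Rightarrow> bool" where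
  "frolov_matrix B \<longleftrightarrow>
     invertible B \<and>
     (\<forall>m. m \<noteq> 0 \<longrightarrow> \<bar>\<Prod>j\<in>UNIV. (B *v of_int_vec m) $ j\<bar> \<ge> 1) \<and>
     (\<forall>x y. finite (range (\<lambda>m. B *v of_int_vec m) \<inter> corner_box x y) \<and>
            real (card (range (\<lambda>m. B *v of_int_vec m) \<inter> corner_box x y))
              \<le> (\<Prod>j\<in>UNIV. \<bar>x $ j - y $ j\<bar>) + 1)"

definition quadrature :: "real ^ 'd ^ 'd \<Rightarrow> real ^ 'd \<Rightarrow> (real ^ 'd \<Rightarrow> real) \<Rightarrow> real" where
  "quadrature S v f =
     1 / \<bar>det S\<bar> * (\<Sum>\<^sub>\<infinity>m\<in>UNIV. f (transpose (matrix_inv S) *v (of_int_vec m + v)))"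

definition partial_deriv :: "'d \<Rightarrow> (real ^ 'd \<Rightarrow> real) \<Rightarrow> real ^ 'd \<Rightarrow> real" where
  "partial_deriv j \<phi> x = deriv (\<lambda>t. \<phi> (x + t *\<^sub>R axis j 1)) 0"

primrec iter_partial :: "'d list \<Rightarrow> (real ^ 'd \<Rightarrow> real) \<Rightarrow> real ^ 'd \<Rightarrow> real" where
  "iter_partial [] \<phi> = \<phi>"
| "iter_partial (j # js) \<phi> = partial_deriv j (iter_partial js \<phi>)"

text \<open>
  Differentiability of every iterated partial derivative also makes each of them continuous, so the
  first condition is smoothness.
\<close>

definition test_function :: "(real ^ 'd \<Rightarrow> real) \<Rightarrow> bool" where
  "test_function \<phi> \<longleftrightarrow>
     (\<forall>js. iter_partial js \<phi> differentiable_on UNIV) \<and> compact (closure {x. \<phi> x \<noteq> 0})"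

definition locally_integrable :: "(real ^ 'd \<Rightarrow> real) \<Rightarrow> bool" where
  "locally_integrable f \<longleftrightarrow> (\<forall>K. compact K \<longrightarrow> set_integrable lborel K f)"

definition square_integrable :: "(real ^ 'd \<Rightarrow> real) \<Rightarrow> bool" where
  "square_integrable f \<longleftrightarrow> f \<in> borel_measurable lborel \<and> integrable lborel (\<lambda>x. (f x)\<^sup>2)"

text \<open>
  \<open>js\<close> lists the directions of differentiation, direction \<open>j\<close> occurring \<open>\<alpha> $ j\<close> times, so that
  \<open>iter_partial js \<phi>\<close> is the classical derivative of \<open>\<phi>\<close> for the multi-index \<open>\<alpha>\<close>. By symmetry of
  the partial derivatives of smooth functions it does not depend on the order of \<open>js\<close>.
\<close>

definition has_weak_deriv ::
  "nat ^ 'd \<Rightarrow> (real ^ 'd \<Rightarrow> real) \<Rightarrow> (real ^ 'd \<Rightarrow> real) \<Rightarrow> bool" where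
  "has_weak_deriv \<alpha> f g \<longleftrightarrow>
     locally_integrable f \<and> locally_integrable g \<and>
     (\<forall>\<phi> js. test_function \<phi> \<longrightarrow> (\<forall>j. count_list js j = \<alpha> $ j) \<longrightarrow>
        (LINT x|lborel. f x * iter_partial js \<phi> x)
          = (-1) ^ (\<Sum>j\<in>UNIV. \<alpha> $ j) * (LINT x|lborel. g x * \<phi> x))"

text \<open>Weak derivatives are unique almost everywhere; this picks a version.\<close>

definition weak_deriv :: "nat ^ 'd \<Rightarrow> (real ^ 'd \<Rightarrow> real) \<Rightarrow> real ^ 'd \<Rightarrow> real" where
  "weak_deriv \<alpha> f = (SOME g. has_weak_deriv \<alpha> f g \<and> square_integrable g)"

definition mix_indices :: "nat \<Rightarrow> (nat ^ 'd) set" where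
  "mix_indices r = {\<alpha>. \<forall>j. \<alpha> $ j \<le> r}"

text \<open>
  Every class in the Sobolev space has exactly one continuous representative when \<open>r \<ge> 1\<close>;
  the space is taken to consist of these representatives.
\<close>

definition Hmix :: "nat \<Rightarrow> (real ^ 'd \<Rightarrow> real) set" where
  "Hmix r = {f. continuous_on UNIV f \<and> square_integrable f \<and>
     (\<forall>\<alpha>\<in>mix_indices r. \<exists>g. has_weak_deriv \<alpha> f g \<and> square_integrable g)}"

definition Hmix_unit_cube :: "nat \<Rightarrow> (real ^ 'd \<Rightarrow> real) set" where
  "Hmix_unit_cube r = {f \<in> Hmix r. closure {x. f x \<noteq> 0} \<subseteq> cbox 0 1}"

definition Hmix_norm :: "nat \<Rightarrow> (real ^ 'd \<Rightarrow> real) \<Rightarrow> real" where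
  "Hmix_norm r f =
     sqrt (\<Sum>\<alpha>\<in>mix_indices r. LINT x:cbox 0 1|lborel. (weak_deriv \<alpha> f x)\<^sup>2)"

end

theory Submission
  imports Defs
begin

text \<open>
  For fixed \<open>U\<close> the error is a function of the shift \<open>V\<close> that is periodic with respect to the integer
  lattice, and its Fourier coefficient at \<open>k \<noteq> 0\<close> is the Fourier transform \<open>\<F> f\<close> at \<open>S k\<close>, where
  \<open>S = n\<^sup>1\<^sup>/\<^sup>d U B\<close>. By Parseval, averaging over \<open>V\<close> gives \<open>\<Sum>k\<noteq>0. |\<F> f (S k)|\<^sup>2\<close>. Averaging each
  summand over \<open>U\<close> spreads the point \<open>S k\<close> over a box; every \<open>x\<close> is covered with total weight at most
  \<open>4 / n\<close> because the count of lattice points in a box compensates the volumes of the boxes, and it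
  is covered only if \<open>|x\<^sub>1 \<cdots> x\<^sub>d| \<ge> n\<close> because nonzero lattice points \<open>B k\<close>
  have coordinate products of absolute value at least 1.
  On that set \<open>|\<F> f| \<le> n\<^sup>-\<^sup>r |\<F> (D\<^sup>(\<^sup>r\<^sup>,\<^sup>\<dots>\<^sup>,\<^sup>r\<^sup>) f)|\<close>, and Bessel's inequality on the translates of the
  unit cell bounds the \<open>L\<^sup>2\<close> norm of the latter.
\<close>

section \<open>Linear change of variables\<close>

text \<open>The random shift turns the squared error into an orthogonal sum, so Poisson summation is
  used only through the coefficients of a continuous periodic function, and no absolute convergence
  of the dual lattice sum enters. The random dilation produces the extra factor
  \<open>n powr (-1/2)\<close>: for a fixed matrix the sum over the nonzero points
  \<open>S k\<close> samples the Fourier transform pointwise, while its average over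
  \<open>U\<close> is an integral over a region, which an L2 bound controls. The dilation interval
  ends at \<open>2 powr (1/d)\<close> so that the coordinate product varies at most by the factor 2;
  the weight of one lattice point and the number of points that reach \<open>x\<close> then balance.

  The main obstacle is the weak derivative: it is tested only against compactly supported smooth
  functions, which characters are not, and its values outside the cube are not prescribed. Cutoffs
  that equal 1 on the cube and shrink to it resolve both difficulties: they are invisible on the
  side of \<open>f\<close>, and dominated convergence removes them on the side of the
  derivative.\<close>

text \<open>
  The change of variables in HOL-Analysis needs a well-ordered index type, which \<open>'d\<close> is not.
  Here it is derived for every finite index type from elementary matrices.
\<close>

lemma lborel_eqI_cart:
  fixes M :: "(real^'d) measure"
  assumes "\<And>l u. (\<And>i. l $ i \<le> u $ i) \<Longrightarrow> emeasure M (box l u) = ennreal (\<Prod>i\<in>UNIV. u $ i - l $ i)"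
    and "sets M = sets borel"
  shows "lborel = M"
proof (rule lborel_eqI)
  fix l u :: "real^'d" assume le: "\<And>b. b \<in> Basis \<Longrightarrow> l \<bullet> b \<le> u \<bullet> b"
  have "(\<Prod>b\<in>Basis. (u - l) \<bullet> b) = (\<Prod>i\<in>UNIV. u $ i - l $ i)"
    by (simp add: Basis_vec_def UNION_singleton_eq_range prod.reindex axis_eq_axis inj_on_def inner_axis)
  moreover have "l $ i \<le> u $ i" for i
    using le[of "axis i 1"] by (simp add: axis_in_Basis_iff inner_axis)
  ultimately show "emeasure M (box l u) = ennreal (\<Prod>b\<in>Basis. (u - l) \<bullet> b)"
    using assms(1) by simp
qed (fact assms(2))

lemma emeasure_lborel_box_cart:
  fixes l u :: "real^'d"
  assumes "\<And>i. l $ i \<le> u $ i"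
  shows "emeasure lborel (box l u) = ennreal (\<Prod>i\<in>UNIV. u $ i - l $ i)"
proof -
  have "(\<Prod>b\<in>Basis. (u - l) \<bullet> b) = (\<Prod>i\<in>UNIV. u $ i - l $ i)"
    by (simp add: Basis_vec_def UNION_singleton_eq_range prod.reindex axis_eq_axis inj_on_def inner_axis)
  then show ?thesis using assms
    by (subst emeasure_lborel_box) (auto simp: Basis_vec_def inner_axis)
qed

lemma borel_measurable_vec_lambda:
  fixes f :: "'a \<Rightarrow> 'd::finite \<Rightarrow> real"
  assumes "\<And>i. (\<lambda>x. f x i) \<in> borel_measurable M"
  shows "(\<lambda>x. \<chi> i. f x i) \<in> borel_measurable M"
  unfolding borel_measurable_euclidean_space[of "\<lambda>x. \<chi> i. f x i"]
  using assms by (auto simp: Basis_vec_def inner_axis)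

lemma borel_measurable_vec_nth [measurable (raw)]:
  fixes f :: "'a \<Rightarrow> real^'d"
  assumes "f \<in> borel_measurable M"
  shows "(\<lambda>x. f x $ i) \<in> borel_measurable M"
  by (rule measurable_compose[OF assms])
     (intro borel_measurable_continuous_onI continuous_on_component continuous_on_id)

lemma measurable_matrix_vector_mult [measurable]:
  fixes A :: "real^'d^'d"
  shows "(\<lambda>x. A *v x) \<in> borel_measurable borel"
  by (intro borel_measurable_continuous_onI continuous_intros)

lemma lborel_stretch:
  fixes c :: "'d::finite \<Rightarrow> real"
  assumes c: "\<And>i. c i \<noteq> 0"
  shows "lborel = density (distr lborel borel (\<lambda>x. \<chi> i. c i * x $ i))
    (\<lambda>_. ennreal \<bar>\<Prod>i\<in>UNIV. c i\<bar>)"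
proof (rule lborel_eqI_cart)
  let ?f = "\<lambda>x::real^'d. \<chi> i. c i * x $ i"
  fix l u :: "real^'d" assume le: "\<And>i. l $ i \<le> u $ i"
  have [measurable]: "?f \<in> borel \<rightarrow>\<^sub>M borel"
    by (rule borel_measurable_vec_lambda) measurable
  have eq: "?f -` box l u = box (\<chi> i. if 0 < c i then l $ i / c i else u $ i / c i)
     (\<chi> i. if 0 < c i then u $ i / c i else l $ i / c i)"
  proof -
    have "l $ i < c i * y \<and> c i * y < u $ i \<longleftrightarrow> (if 0 < c i then l $ i / c i else u $ i / c i) < y \<and>
        y < (if 0 < c i then u $ i / c i else l $ i / c i)" for i y
      using c[of i] by (cases "0 < c i") (auto simp: field_simps)
    then show ?thesis by (simp add: set_eq_iff mem_box_cart)
  qed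
  have "emeasure lborel (?f -` box l u) = ennreal (\<Prod>i\<in>UNIV. (u $ i - l $ i) / \<bar>c i\<bar>)"
    unfolding eq
  proof (subst emeasure_lborel_box_cart)
    show "(\<chi> i. if 0 < c i then l $ i / c i else u $ i / c i) $ i
        \<le> (\<chi> i. if 0 < c i then u $ i / c i else l $ i / c i) $ i" for i
      using le[of i] by (simp add: divide_right_mono divide_right_mono_neg)
    have "(if 0 < c i then u $ i / c i else l $ i / c i) - (if 0 < c i then l $ i / c i else u $ i / c i)
        = (u $ i - l $ i) / \<bar>c i\<bar>" for i
      using c[of i] by (auto simp: field_simps)
    then show "ennreal (\<Prod>i\<in>UNIV. (\<chi> i. if 0 < c i then u $ i / c i else l $ i / c i) $ i
        - (\<chi> i. if 0 < c i then l $ i / c i else u $ i / c i) $ i)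
      = ennreal (\<Prod>i\<in>UNIV. (u $ i - l $ i) / \<bar>c i\<bar>)" by simp
  qed
  then show "emeasure (density (distr lborel borel ?f) (\<lambda>_. ennreal \<bar>\<Prod>i\<in>UNIV. c i\<bar>)) (box l u)
     = ennreal (\<Prod>i\<in>UNIV. u $ i - l $ i)"
    using c le
    by (simp add: emeasure_density_const emeasure_distr ennreal_mult[symmetric] abs_prod
       prod.distrib[symmetric] prod_nonneg)
qed simp

lemma lborel_permute:
  fixes p :: "'d::finite \<Rightarrow> 'd"
  assumes p: "bij p"
  shows "lborel = distr lborel borel (\<lambda>x::real^'d. \<chi> i. x $ p i)"
proof (rule lborel_eqI_cart)
  let ?f = "\<lambda>x::real^'d. \<chi> i. x $ p i"
  fix l u :: "real^'d" assume le: "\<And>i. l $ i \<le> u $ i"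
  have [measurable]: "?f \<in> borel \<rightarrow>\<^sub>M borel"
    by (rule borel_measurable_vec_lambda) measurable
  have pi: "p (inv p i) = i" "inv p (p i) = i" for i
    using p by (auto simp: bij_is_surj surj_f_inv_f bij_is_inj)
  have eq: "?f -` box l u = box (\<chi> i. l $ inv p i) (\<chi> i. u $ inv p i)"
    by (auto simp: mem_box_cart) (metis pi)+
  have "(\<Prod>i\<in>UNIV. u $ inv p i - l $ inv p i) = (\<Prod>i\<in>UNIV. u $ i - l $ i)"
    by (rule prod.reindex_bij_betw[where h="inv p"]) (simp add: bij_imp_bij_inv p)
  then show "emeasure (distr lborel borel ?f) (box l u) = ennreal (\<Prod>i\<in>UNIV. u $ i - l $ i)"
    using le by (simp add: emeasure_distr eq emeasure_lborel_box_cart)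
qed simp

lemma lborel_distr_shear:
  fixes m n :: "'d::finite"
  assumes "m \<noteq> n"
  shows "distr lborel borel (\<lambda>x::real^'d. \<chi> i. if i = m then x $ m + x $ n else x $ i) = lborel"
proof -
  let ?f = "\<lambda>x::real^'d. \<chi> i. if i = m then x $ m + x $ n else x $ i"
  let ?g = "\<lambda>x::real^'d. \<chi> i. if i = m then x $ m - x $ n else x $ i"
  have f[measurable]: "?f \<in> borel \<rightarrow>\<^sub>M borel" and g[measurable]: "?g \<in> borel \<rightarrow>\<^sub>M borel"
    by (rule borel_measurable_vec_lambda, measurable)+
  have fg: "?f (?g x) = x" "?g (?f x) = x" for x using assms by (auto simp: vec_eq_iff)
  have lin: "linear ?f"
    by (rule linearI) (auto simp: vec_eq_iff algebra_simps)
  have im: "?g -` S = ?f ` S" for S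
  proof -
    have "x \<in> ?f ` S" if "?g x \<in> S" for x
      using that fg(1)[of x] by (intro image_eqI[of x ?f "?g x"]) (simp_all only:)
    moreover have "?g (?f x) \<in> S" if "x \<in> S" for x
      using that by (simp only: fg)
    ultimately show ?thesis by blast
  qed
  \<comment> \<open>Preimages under the inverse shear \<open>?g\<close> are images under
    \<open>?f\<close>, to which the known volume of a sheared box applies; pushing this identity
    forward along \<open>?f\<close> then gives the claim.\<close>
  have "lborel = distr lborel borel ?g"
  proof (rule lborel_eqI_cart)
    fix l u :: "real^'d" assume le: "\<And>i. l $ i \<le> u $ i"
    \<comment> \<open>\<open>measure_shear_interval\<close> asks for a nonnegative
      \<open>n\<close>-th coordinate of the lower corner; after subtracting \<open>t\<close> it is
      0.\<close>
    define t where "t = (\<chi> i. if i = n then l $ n else 0)"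
    have ne: "cbox (l - t) (u - t) \<noteq> {}" using le by (auto simp: interval_ne_empty_cart t_def)
    have bc: "?f ` cbox (l-t) (u-t) \<in> sets borel" and bb: "?f ` box l u \<in> sets borel"
      by (subst im[symmetric], rule measurable_sets_borel[OF g], simp)+
    have meas: "measure lebesgue (?f ` cbox (l - t) (u - t)) = measure lebesgue (cbox (l - t) (u - t))"
      by (rule measure_shear_interval[OF assms ne]) (simp add: t_def)
    have cb: "cbox l u = (+) t ` cbox (l - t) (u - t)"
      by (simp add: cbox_translation[symmetric])
    have "emeasure lborel (?f ` box l u) = emeasure lebesgue (?f ` box l u)"
      using bb by simp
    \<comment> \<open>The shear maps the null set between the open and the closed box to a null
      set.\<close>
    also have "\<dots> = emeasure lebesgue (?f ` cbox l u)"
    proof (rule emeasure_eq_AE)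
      have "negligible (?f ` (cbox l u - box l u))"
        using negligible_frontier_interval
        by (rule negligible_differentiable_image_negligible[rotated])
           (auto intro!: linear_imp_differentiable_on lin)
      then have "AE x in lebesgue. x \<notin> ?f ` (cbox l u - box l u)"
        by (simp add: negligible_iff_null_sets AE_not_in)
      then show "AE x in lebesgue. x \<in> ?f ` box l u \<longleftrightarrow> x \<in> ?f ` cbox l u"
        by eventually_elim (use box_subset_cbox[of l u] in blast)
    next
      have "?g -` cbox l u \<in> sets borel" by (rule measurable_sets_borel[OF g]) simp
      then show "?f ` cbox l u \<in> sets lebesgue" by (simp add: im[symmetric])
    qed (use bb in simp)
    also have "?f ` cbox l u = (+) (?f t) ` ?f ` cbox (l - t) (u - t)"
      unfolding cb image_image linear_add[OF lin] ..
    also have "emeasure lebesgue \<dots> = emeasure lebesgue (?f ` cbox (l - t) (u - t))"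
    proof -
      have "(\<lambda>x. 1 *\<^sub>R x + ?f t) = (+) (?f t)"
        by (rule ext) (simp only: scaleR_one add.commute)
      then show ?thesis
        using emeasure_lebesgue_affine[of 1 "?f t" "?f ` cbox (l - t) (u - t)"] by (simp only: power_one mult_1 abs_one ennreal_1)
    qed
    also have "\<dots> = ennreal (measure lebesgue (?f ` cbox (l - t) (u - t)))"
      using measurable_shear_interval[OF assms ne, of] by (intro emeasure_eq_measure2) (simp_all add: t_def)
    also have "\<dots> = ennreal (\<Prod>i\<in>UNIV. u $ i - l $ i)"
      using ne unfolding meas by (simp add: content_cbox_cart)
    finally show "emeasure (distr lborel borel ?g) (box l u) = ennreal (\<Prod>i\<in>UNIV. u $ i - l $ i)"
      by (simp add: emeasure_distr im)
  qed simp
  then have "distr lborel borel ?f = distr (distr lborel borel ?g) borel ?f" by simp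
  also have "\<dots> = distr lborel borel (\<lambda>x. x)"
    by (subst distr_distr) (auto simp: o_def fg)
  finally show ?thesis by (simp add: distr_id2)
qed


text \<open>An identity of measures composes: under \<open>A ** B\<close> the densities multiply as
  the determinants do. The elementary matrices are stretches, transpositions of coordinates and
  shears; a zero row contradicts the nonzero determinant.\<close>

lemma lborel_matrix:
  fixes A :: "real^'d^'d"
  assumes "det A \<noteq> 0"
  shows "lborel = density (distr lborel borel ((*v) A)) (\<lambda>_. ennreal \<bar>det A\<bar>)"
  using assms
proof (induction A rule: induct_matrix_elementary_alt)
  case (1 A B)
  then have d: "det A \<noteq> 0" "det B \<noteq> 0" by (auto simp: det_mul)
  have "density (distr lborel borel ((*v) (A ** B))) (\<lambda>_. ennreal \<bar>det (A ** B)\<bar>) =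
    density (density (distr (distr lborel borel ((*v) B)) borel ((*v) A)) (\<lambda>_. ennreal \<bar>det B\<bar>)) (\<lambda>_. ennreal \<bar>det A\<bar>)"
    by (subst density_density_eq)
       (auto simp: distr_distr o_def det_mul abs_mult ennreal_mult mult.commute matrix_vector_mul_assoc)
  also have "density (distr (distr lborel borel ((*v) B)) borel ((*v) A)) (\<lambda>_. ennreal \<bar>det B\<bar>) =
     distr (density (distr lborel borel ((*v) B)) (\<lambda>_. ennreal \<bar>det B\<bar>)) borel ((*v) A)"
    by (rule density_distr) auto
  also have "\<dots> = distr lborel borel ((*v) A)"
    using 1(2)[OF d(2)] by simp
  also have "density \<dots> (\<lambda>_. ennreal \<bar>det A\<bar>) = lborel"
    using 1(1)[OF d(1)] by simp
  finally show ?case by simp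
next
  case (2 A i)
  then show ?case using det_zero_row by blast
next
  case (3 A)
  have eq: "(*v) A = (\<lambda>x. \<chi> i. A $ i $ i * x $ i)"
  proof (intro ext, simp add: vec_eq_iff matrix_vector_mult_def, intro allI)
    fix x :: "real^'d" and i
    have "(\<Sum>j\<in>UNIV. A $ i $ j * x $ j) = (\<Sum>j\<in>{i}. A $ i $ j * x $ j)"
      by (rule sum.mono_neutral_right) (auto simp: 3)
    then show "(\<Sum>j\<in>UNIV. A $ i $ j * x $ j) = A $ i $ i * x $ i" by simp
  qed
  have "A $ i $ i \<noteq> 0" for i
    using 3 det_diagonal[of A] by auto
  then show ?case
    unfolding eq using lborel_stretch[of "\<lambda>i. A $ i $ i"] 3(1) by (simp add: det_diagonal)
next
  case (4 m n)
  have p: "Transposition.transpose m n permutes UNIV" by (simp add: permutes_swap_id)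
  have b: "bij (Transposition.transpose m n)" by simp
  have "det (\<chi> i j. mat 1 $ i $ Transposition.transpose m n j :: real^'d^'d) = of_int (sign (Transposition.transpose m n))"
    using det_permute_columns[OF p, of "mat 1 :: real^'d^'d"] by simp
  then have "\<bar>det (\<chi> i j. mat 1 $ i $ Transposition.transpose m n j :: real^'d^'d)\<bar> = 1"
    by (simp add: sign_def)
  moreover have "(*v) (\<chi> i j. mat 1 $ i $ Transposition.transpose m n j) = (\<lambda>x::real^'d. \<chi> i. x $ Transposition.transpose m n i)"
  proof (intro ext, simp add: vec_eq_iff matrix_vector_mult_def mat_def, intro allI)
    fix x :: "real^'d" and i
    have "(\<Sum>j\<in>UNIV. (if i = Transposition.transpose m n j then 1 else 0) * x $ j) =
       (\<Sum>j\<in>UNIV. if j = Transposition.transpose m n i then x $ j else 0)"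
      by (intro sum.cong refl) (auto simp: transpose_eq_iff)
    then show "(\<Sum>j\<in>UNIV. (if i = Transposition.transpose m n j then 1 else 0) * x $ j) = x $ Transposition.transpose m n i"
      by simp
  qed
  ultimately show ?case
    using lborel_permute[OF b] by (simp add: density_1)
next
  case (5 m n)
  have eqm: "(\<chi> i j. of_bool (i = m \<and> j = n \<or> i = j)) =
     (\<chi> k. if k = m then row m (mat 1) + 1 *s row n (mat 1) else row k (mat 1 :: real^'d^'d))"
    using 5 by (auto simp: vec_eq_iff row_def mat_def)
  have "det (\<chi> i j. of_bool (i = m \<and> j = n \<or> i = j) :: real^'d^'d) = 1"
    unfolding eqm by (subst det_row_operation[OF 5(1)]) simp
  moreover have "(*v) (\<chi> i j. of_bool (i = m \<and> j = n \<or> i = j)) = (\<lambda>x::real^'d. \<chi> i. if i = m then x $ m + x $ n else x $ i)"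
  proof (rule ext, rule vec_eq_iff[THEN iffD2], rule allI)
    fix x :: "real^'d" and i
    have "(\<Sum>j\<in>UNIV. of_bool (i = m \<and> j = n \<or> i = j) * x $ j) =
       (\<Sum>j\<in>UNIV. (if j = i then x $ j else 0) + (if i = m \<and> j = n then x $ j else 0))"
      using 5 by (intro sum.cong refl) auto
    also have "\<dots> = x $ i + (if i = m then x $ n else 0)"
      by (simp add: sum.distrib)
    finally show "((\<chi> i j. of_bool (i = m \<and> j = n \<or> i = j)) *v x) $ i =
        (\<chi> i. if i = m then x $ m + x $ n else x $ i) $ i"
      by (simp add: matrix_vector_mult_def)
  qed
  ultimately show ?case
    using lborel_distr_shear[OF 5(1)] by (simp add: density_1)
qed

lemma integral_lborel_matrix:
  fixes A :: "real^'d^'d" and f :: "real^'d \<Rightarrow> 'b::{banach, second_countable_topology}"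
  assumes "det A \<noteq> 0" and [measurable]: "f \<in> borel_measurable borel"
  shows "(LINT x|lborel. f x) = \<bar>det A\<bar> *\<^sub>R (LINT x|lborel. f (A *v x))"
  by (subst lborel_matrix[OF assms(1)])
     (simp add: integral_density integral_distr)

section \<open>Fourier coefficients on the torus\<close>

text \<open>Half-open, so that every point has exactly one integer translate in it; it differs from
  the closed cube by a null set.\<close>

definition unit_cell :: "(real^'d) set" where
  "unit_cell = {x. \<forall>i. 0 \<le> x $ i \<and> x $ i < 1}"

text \<open>The uniform measure on the closed cube is the law of \<open>V\<close> in the theorem;
  computations pass to \<open>unit_cell\<close> through \<open>nn_integral_torus\<close> and
  \<open>integral_torus\<close>.\<close>

abbreviation (input) torus :: "(real^'d) measure" where
  "torus \<equiv> uniform_measure lborel (cbox 0 1)"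

definition character :: "real^'d \<Rightarrow> real^'d \<Rightarrow> complex" where
  "character \<xi> x = cis (2 * pi * (\<xi> \<bullet> x))"

lemma of_int_vec_index [simp]: "of_int_vec m $ i = real_of_int (m $ i)"
  by (simp add: of_int_vec_def)

lemma of_int_vec_add: "of_int_vec (k + m) = of_int_vec k + of_int_vec m"
  by (simp add: vec_eq_iff)

lemma of_int_vec_diff: "of_int_vec (k - m) = of_int_vec k - of_int_vec m"
  by (simp add: vec_eq_iff)

lemma of_int_vec_uminus: "of_int_vec (- m) = - of_int_vec m"
  by (simp add: vec_eq_iff)

lemma of_int_vec_0 [simp]: "of_int_vec 0 = 0"
  by (simp add: vec_eq_iff)

lemma inj_of_int_vec: "inj of_int_vec"
  by (auto simp: inj_on_def vec_eq_iff)

lemma finite_vec_Pi: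
  assumes "\<And>i. finite (A i)"
  shows "finite {m::'a^'d. \<forall>i. m $ i \<in> A i}"
proof (rule finite_subset)
  show "{m::'a^'d. \<forall>i. m $ i \<in> A i} \<subseteq> vec_lambda ` (PiE UNIV A)"
  proof
    fix m :: "'a^'d" assume "m \<in> {m. \<forall>i. m $ i \<in> A i}"
    then show "m \<in> vec_lambda ` (PiE UNIV A)"
      by (intro image_eqI[of _ _ "vec_nth m"]) auto
  qed
qed (auto intro!: finite_imageI finite_PiE assms)

lemma finite_int_vec_box: "finite {m::int^'d. \<forall>i. a i \<le> m $ i \<and> m $ i \<le> b i}"
  using finite_vec_Pi[of "\<lambda>i. {a i..b i}"] by simp

lemma unit_cell_borel [measurable]: "unit_cell \<in> sets borel"
proof -
  have "unit_cell = (\<Inter>i. {x::real^'d. 0 \<le> x $ i} \<inter> {x. x $ i < 1})"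
    by (auto simp: unit_cell_def)
  also have "\<dots> \<in> sets borel"
    by (intro sets.countable_INT'' sets.Int borel_closed borel_open
        closed_halfspace_component_ge_cart open_halfspace_component_lt_cart) auto
  finally show ?thesis .
qed

lemma AE_open_cube_iff: "AE x in lborel. x \<in> box 0 (1::real^'d) \<longleftrightarrow> x \<in> cbox 0 1"
proof -
  have "AE x in lebesgue. x \<notin> cbox 0 (1::real^'d) - box 0 1"
    using negligible_frontier_interval[of 0 "1::real^'d"]
    unfolding negligible_iff_null_sets by (rule AE_not_in)
  then have "AE x in lborel. x \<notin> cbox 0 (1::real^'d) - box 0 1"
    by (simp add: AE_completion_iff)
  then show ?thesis
    using box_subset_cbox[of 0 "1::real^'d"] by (auto elim!: eventually_mono)
qed

lemma AE_unit_cell_iff: "AE x in lborel. x \<in> unit_cell \<longleftrightarrow> x \<in> cbox 0 (1::real^'d)"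
  using AE_open_cube_iff
  by (auto elim!: eventually_mono simp: unit_cell_def mem_box_cart less_imp_le)

lemma emeasure_unit_cube: "emeasure lborel (cbox 0 (1::real^'d)) = 1"
  by (subst emeasure_lborel_cbox_eq) (auto simp: Basis_vec_def inner_axis intro!: prod.neutral)

lemma emeasure_unit_cell: "emeasure lborel (unit_cell :: (real^'d) set) = 1"
  using AE_unit_cell_iff by (subst emeasure_unit_cube[symmetric]) (auto intro!: emeasure_eq_AE)

lemma torus_eq_density: "torus = density lborel (indicator (unit_cell :: (real^'d) set))"
  unfolding uniform_measure_def emeasure_unit_cube
  using AE_unit_cell_iff
  by (intro density_cong) (auto elim!: eventually_mono simp: indicator_def)

lemma prob_space_torus: "prob_space torus"
  by (intro prob_space_uniform_measure) (simp_all add: emeasure_unit_cube)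

lemma nn_integral_torus:
  assumes [measurable]: "f \<in> borel_measurable borel"
  shows "(\<integral>\<^sup>+x. f x \<partial>torus) = (\<integral>\<^sup>+x. indicator unit_cell x * f x \<partial>lborel)"
  unfolding torus_eq_density by (subst nn_integral_density) auto

lemma integral_torus:
  fixes f :: "real^'d \<Rightarrow> 'b::{banach, second_countable_topology}"
  assumes [measurable]: "f \<in> borel_measurable borel"
  shows "(LINT x|torus. f x) = (LINT x|lborel. indicator unit_cell x *\<^sub>R f x)"
proof -
  have "torus = density lborel (\<lambda>x. ennreal (indicator (unit_cell :: (real^'d) set) x))"
    unfolding torus_eq_density by (intro arg_cong2[where f=density]) (auto simp: fun_eq_iff indicator_def)
  then show ?thesis by (simp add: integral_density)
qed

section \<open>Unfolding integrals along the integer lattice\<close>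

lemma unit_cell_translate_ex1: "\<exists>!m. x - of_int_vec m \<in> (unit_cell :: (real^'d) set)"
proof (rule ex1I[of _ "\<chi> i. \<lfloor>x $ i\<rfloor>"])
  show "x - of_int_vec (\<chi> i. \<lfloor>x $ i\<rfloor>) \<in> unit_cell"
    by (auto simp: unit_cell_def) linarith
  fix m assume "x - of_int_vec m \<in> (unit_cell :: (real^'d) set)"
  then have "0 \<le> x $ i - m $ i \<and> x $ i - m $ i < 1" for i
    by (auto simp: unit_cell_def)
  then have "m $ i = \<lfloor>x $ i\<rfloor>" for i
    by (smt (verit) floor_unique)
  then show "m = (\<chi> i. \<lfloor>x $ i\<rfloor>)" by (simp add: vec_eq_iff)
qed

lemma nn_integral_lborel_translate:
  fixes f :: "real^'d \<Rightarrow> ennreal"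
  assumes [measurable]: "f \<in> borel_measurable borel"
  shows "(\<integral>\<^sup>+x. f (x + t) \<partial>lborel) = (\<integral>\<^sup>+x. f x \<partial>lborel)"
  by (subst (2) lborel_distr_plus[of t, symmetric]) (simp add: nn_integral_distr add.commute)

lemma integral_lborel_translate:
  fixes f :: "real^'d \<Rightarrow> 'b::{banach, second_countable_topology}"
  assumes [measurable]: "f \<in> borel_measurable borel"
  shows "(LINT x|lborel. f (x + t)) = (LINT x|lborel. f x)"
  by (subst (2) lborel_distr_plus[of t, symmetric]) (simp add: integral_distr add.commute)

lemma integrable_lborel_translate_iff:
  fixes f :: "real^'d \<Rightarrow> 'b::{banach, second_countable_topology}"
  assumes [measurable]: "f \<in> borel_measurable borel"
  shows "integrable lborel (\<lambda>x. f (x + t)) \<longleftrightarrow> integrable lborel f"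
  by (subst (2) lborel_distr_plus[of t, symmetric]) (simp add: integrable_distr_eq add.commute)

text \<open>Insert the indicators of the translated cells, which sum to 1 at every point, and
  translate each piece back to the cell.\<close>

lemma nn_integral_unfold_lattice:
  fixes f :: "real^'d \<Rightarrow> ennreal"
  assumes [measurable]: "f \<in> borel_measurable borel"
  shows "(\<integral>\<^sup>+x. f x \<partial>lborel) =
    (\<integral>\<^sup>+x. \<integral>\<^sup>+m. f (x + of_int_vec m) \<partial>count_space UNIV \<partial>torus)"
proof -
  have "(\<integral>\<^sup>+x. f x \<partial>lborel) =
      (\<integral>\<^sup>+x. \<integral>\<^sup>+m. f x * indicator unit_cell (x - of_int_vec m) \<partial>count_space UNIV \<partial>lborel)"
  proof (rule nn_integral_cong)
    fix x :: "real^'d"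
    obtain m0 where m0: "\<And>m. x - of_int_vec m \<in> unit_cell \<longleftrightarrow> m = m0"
      using unit_cell_translate_ex1[of x] by blast
    have "(\<integral>\<^sup>+m. f x * indicator unit_cell (x - of_int_vec m) \<partial>count_space UNIV) =
       (\<Sum>m\<in>{m0}. f x * indicator unit_cell (x - of_int_vec m))"
      by (rule nn_integral_count_space') (use m0 in \<open>auto simp: indicator_def\<close>)
    then show "f x = (\<integral>\<^sup>+m. f x * indicator unit_cell (x - of_int_vec m) \<partial>count_space UNIV)"
      using m0 by simp
  qed
  also have "\<dots> = (\<integral>\<^sup>+m. \<integral>\<^sup>+x. f x * indicator unit_cell (x - of_int_vec m) \<partial>lborel \<partial>count_space UNIV)"
    by (rule nn_integral_count_space_nn_integral) auto
  also have "\<dots> = (\<integral>\<^sup>+m. \<integral>\<^sup>+x. f (x + of_int_vec m) * indicator unit_cell x \<partial>lborel \<partial>count_space UNIV)"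
  proof (rule nn_integral_cong)
    fix m :: "int^'d"
    show "(\<integral>\<^sup>+x. f x * indicator unit_cell (x - of_int_vec m) \<partial>lborel) =
        (\<integral>\<^sup>+x. f (x + of_int_vec m) * indicator unit_cell x \<partial>lborel)"
      by (subst nn_integral_lborel_translate[where t="of_int_vec m", symmetric]) auto
  qed
  also have "\<dots> = (\<integral>\<^sup>+m. \<integral>\<^sup>+x. f (x + of_int_vec m) \<partial>torus \<partial>count_space UNIV)"
    by (intro nn_integral_cong) (simp add: nn_integral_torus mult.commute)
  also have "\<dots> = (\<integral>\<^sup>+x. \<integral>\<^sup>+m. f (x + of_int_vec m) \<partial>count_space UNIV \<partial>torus)"
    by (rule nn_integral_count_space_nn_integral[symmetric]) auto
  finally show ?thesis .
qed

text \<open>The Bochner counterpart. A bounded support meets only finitely many translates of the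
  cell, so a finite index set \<open>A\<close> replaces summability.\<close>

lemma integral_unfold_lattice:
  fixes f :: "real^'d \<Rightarrow> 'b::{banach, second_countable_topology}"
  assumes int: "integrable lborel f" and A: "finite A"
    and supp: "\<And>x m. x \<in> unit_cell \<Longrightarrow> m \<notin> A \<Longrightarrow> f (x + of_int_vec m) = 0"
  shows "(LINT x|lborel. f x) = (LINT x|torus. (\<Sum>m\<in>A. f (x + of_int_vec m)))"
proof -
  have [measurable]: "f \<in> borel_measurable borel" using int by auto
  have intm: "integrable lborel (\<lambda>x. f (x + of_int_vec m))" for m
    using int by (simp add: integrable_lborel_translate_iff)
  have "(LINT x|lborel. f x) = (LINT x|lborel. (\<Sum>m\<in>A. indicator unit_cell (x - of_int_vec m) *\<^sub>R f x))"
  proof (rule Bochner_Integration.integral_cong[OF refl])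
    fix x :: "real^'d"
    obtain m0 where m0: "\<And>m. x - of_int_vec m \<in> unit_cell \<longleftrightarrow> m = m0"
      using unit_cell_translate_ex1[of x] by blast
    have "(\<Sum>m\<in>A. indicator unit_cell (x - of_int_vec m) *\<^sub>R f x) = (\<Sum>m\<in>A. if m = m0 then f x else 0)"
      using m0 by (intro sum.cong refl) (auto simp: indicator_def)
    also have "\<dots> = f x" using A supp[of "x - of_int_vec m0" m0] m0[of m0] by (auto simp: sum.delta)
    finally show "f x = (\<Sum>m\<in>A. indicator unit_cell (x - of_int_vec m) *\<^sub>R f x)" by simp
  qed
  also have "\<dots> = (\<Sum>m\<in>A. LINT x|lborel. indicator unit_cell (x - of_int_vec m) *\<^sub>R f x)"
    by (rule Bochner_Integration.integral_sum)
       (auto intro!: Bochner_Integration.integrable_bound[OF int] simp: indicator_def)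
  also have "\<dots> = (\<Sum>m\<in>A. LINT x|lborel. indicator unit_cell x *\<^sub>R f (x + of_int_vec m))"
  proof (rule sum.cong[OF refl])
    fix m
    show "(LINT x|lborel. indicator unit_cell (x - of_int_vec m) *\<^sub>R f x) =
        (LINT x|lborel. indicator unit_cell x *\<^sub>R f (x + of_int_vec m))"
      by (subst integral_lborel_translate[where t="of_int_vec m", symmetric]) auto
  qed
  also have "\<dots> = (LINT x|lborel. (\<Sum>m\<in>A. indicator unit_cell x *\<^sub>R f (x + of_int_vec m)))"
    by (rule Bochner_Integration.integral_sum[symmetric]) (auto intro!: integrable_mult_indicator intm)
  also have "\<dots> = (LINT x|torus. (\<Sum>m\<in>A. f (x + of_int_vec m)))"
    by (subst integral_torus) (auto simp: scaleR_sum_right)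
  finally show ?thesis .
qed

section \<open>Characters and their orthogonality\<close>

lemma character_add_left: "character (\<xi> + \<eta>) x = character \<xi> x * character \<eta> x"
  by (simp add: character_def cis_mult inner_add_left algebra_simps)

lemma character_add_right: "character \<xi> (x + y) = character \<xi> x * character \<xi> y"
  by (simp add: character_def cis_mult inner_add_right algebra_simps)

lemma character_uminus_left: "character (- \<xi>) x = cnj (character \<xi> x)"
  by (simp add: character_def cis_cnj)

lemma character_0 [simp]: "character 0 x = 1"
  by (simp add: character_def)

lemma norm_character [simp]: "norm (character \<xi> x) = 1"
  by (simp add: character_def)

lemma continuous_character [continuous_intros]:
  "continuous_on S f \<Longrightarrow> continuous_on S (\<lambda>x. character \<xi> (f x))"
  unfolding character_def cis_conv_exp by (intro continuous_intros)

lemma character_measurable [measurable]: "character \<xi> \<in> borel_measurable borel"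
  by (intro borel_measurable_continuous_onI continuous_intros)

lemma character_of_int_vec [simp]: "character (of_int_vec k) (of_int_vec m) = 1"
proof -
  have "of_int_vec k \<bullet> of_int_vec m = of_int (\<Sum>i\<in>UNIV. k $ i * m $ i)"
    by (simp add: inner_vec_def)
  then show ?thesis unfolding character_def by (simp only: cis_multiple_2pi Ints_of_int)
qed

lemma integral_torus_character:
  fixes k :: "int^'d"
  assumes "k \<noteq> 0"
  shows "(LINT x|torus. character (of_int_vec k) x) = 0"
proof -
  let ?e = "character (of_int_vec k)"
  obtain j where j: "k $ j \<noteq> 0" using assms by (auto simp: vec_eq_iff)
  \<comment> \<open>Translation by \<open>t\<close> preserves the integral over the torus and changes the sign of the character.\<close>
  define t where "t = (axis j (1 / (2 * real_of_int (k $ j))) :: real^'d)"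
  have t: "?e t = -1"
    using j by (simp add: t_def character_def inner_axis cis_pi)
  \<comment> \<open>If \<open>x\<close> and \<open>x + m - t\<close> lie in the cell and the
    coordinates of \<open>t\<close> are at most 1/2 in absolute value, then those of
    \<open>m\<close> are below 3/2.\<close>
  define A where "A = {m::int^'d. \<forall>i. -2 \<le> m $ i \<and> m $ i \<le> 2}"
  have A: "finite A" unfolding A_def by (rule finite_int_vec_box)
  have tb: "\<bar>t $ i\<bar> \<le> 1 / 2" for i
  proof -
    have "\<bar>real_of_int (k $ j)\<bar> \<ge> 1" using j by linarith
    then show ?thesis by (auto simp: t_def axis_def field_simps)
  qed
  have mA: "m \<in> A" if "x \<in> unit_cell" "x + of_int_vec m - t \<in> unit_cell" for x m
  proof -
    have "-2 \<le> m $ i \<and> m $ i \<le> 2" for i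
    proof -
      have "0 \<le> x $ i" "x $ i < 1" "0 \<le> x $ i + m $ i - t $ i" "x $ i + m $ i - t $ i < 1"
        using that by (auto simp: unit_cell_def)
      then show ?thesis using tb[of i] by linarith
    qed
    then show ?thesis by (simp add: A_def)
  qed
  \<comment> \<open>\<open>f\<close> is the character restricted to the shifted cell. Translation
    makes its integral the negative of the one over the cell; unfolding makes it equal to the one
    over the cell, because the shifted cell also contains exactly one integer translate of each
    point.\<close>
  define f where "f x = indicator unit_cell (x - t) *\<^sub>R ?e x" for x
  have [measurable]: "f \<in> borel_measurable borel" unfolding f_def by measurable
  have ft: "f (x + t) = indicator unit_cell x *\<^sub>R (- ?e x)" for x
    by (simp add: f_def character_add_right t)
  have "integrable lborel (\<lambda>x. indicator unit_cell x *\<^sub>R (- ?e x))"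
    by (rule integrableI_bounded_set_indicator[where B=1]) (auto simp: emeasure_unit_cell)
  then have intf: "integrable lborel f"
    unfolding ft[symmetric] by (simp add: integrable_lborel_translate_iff)
  have "- (LINT x|torus. ?e x) = (LINT x|torus. - ?e x)" by simp
  also have "\<dots> = (LINT x|lborel. f (x + t))"
    by (simp add: ft integral_torus)
  also have "\<dots> = (LINT x|lborel. f x)" by (rule integral_lborel_translate) simp
  also have "\<dots> = (LINT x|torus. (\<Sum>m\<in>A. f (x + of_int_vec m)))"
    using intf A by (rule integral_unfold_lattice) (use mA in \<open>auto simp: f_def indicator_def\<close>)
  also have "\<dots> = (LINT x|lborel. indicator unit_cell x *\<^sub>R (\<Sum>m\<in>A. f (x + of_int_vec m)))"
    by (rule integral_torus) simp
  also have "\<dots> = (LINT x|lborel. indicator unit_cell x *\<^sub>R ?e x)"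
  proof (rule Bochner_Integration.integral_cong[OF refl])
    fix x :: "real^'d"
    obtain m0 where m0: "\<And>m. x - t - of_int_vec m \<in> unit_cell \<longleftrightarrow> m = m0"
      using unit_cell_translate_ex1[of "x - t"] by blast
    have m0': "x + of_int_vec m - t \<in> unit_cell \<longleftrightarrow> m = - m0" for m
    proof -
      have "x + of_int_vec m - t = x - t - of_int_vec (- m)" by (simp add: of_int_vec_uminus)
      then show ?thesis by (simp only: m0) (auto simp: minus_equation_iff)
    qed
    have "(\<Sum>m\<in>A. f (x + of_int_vec m)) = ?e x" if "x \<in> unit_cell"
    proof -
      have "(\<Sum>m\<in>A. f (x + of_int_vec m)) = (\<Sum>m\<in>A. if m = - m0 then ?e x else 0)"
        by (intro sum.cong refl) (auto simp: f_def m0' indicator_def character_add_right)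
      also have "\<dots> = ?e x" using mA[OF that] m0' A by (simp add: sum.delta)
      finally show ?thesis .
    qed
    then show "indicator unit_cell x *\<^sub>R (\<Sum>m\<in>A. f (x + of_int_vec m)) = indicator unit_cell x *\<^sub>R ?e x"
      by (cases "x \<in> unit_cell") simp_all
  qed
  also have "\<dots> = (LINT x|torus. ?e x)" by (simp add: integral_torus)
  finally show ?thesis by simp
qed


lemma nn_integral_count_space_le:
  fixes f :: "'a::countable \<Rightarrow> ennreal"
  assumes "\<And>F. finite F \<Longrightarrow> (\<Sum>k\<in>F. f k) \<le> C"
  shows "(\<integral>\<^sup>+k. f k \<partial>count_space UNIV) \<le> C"
proof -
  let ?R = "range (to_nat :: 'a \<Rightarrow> nat)"
  have "(\<integral>\<^sup>+k. f k \<partial>count_space UNIV) = (\<integral>\<^sup>+k. f (from_nat (to_nat (k::'a))) \<partial>count_space UNIV)"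
    by simp
  also have "\<dots> = (\<integral>\<^sup>+n. f (from_nat n) \<partial>count_space ?R)"
    by (rule nn_integral_bij_count_space[of "to_nat :: 'a \<Rightarrow> nat" UNIV ?R "\<lambda>n. f (from_nat n)"]) (simp add: bij_betw_def)
  also have "\<dots> = (\<Sum>n. f (from_nat n) * indicator ?R n)"
    by (subst nn_integral_count_space_indicator) (simp_all add: nn_integral_count_space_nat)
  also have "\<dots> \<le> C"
  proof (rule suminf_le_const)
    fix N
    have "(\<Sum>n<N. f (from_nat n) * indicator ?R n) = (\<Sum>n\<in>{..<N} \<inter> ?R. f (from_nat n))"
      by (simp add: sum.inter_restrict indicator_def if_distrib cong: if_cong)
    also have "\<dots> = (\<Sum>k\<in>to_nat -` {..<N}. f k)"
      by (rule sum.reindex_cong[of to_nat]) auto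
    also have "\<dots> \<le> C" by (rule assms) (simp add: finite_vimageI)
    finally show "(\<Sum>n<N. f (from_nat n) * indicator ?R n) \<le> C" .
  qed simp
  finally show ?thesis .
qed

section \<open>Fourier coefficients and Bessel's inequality\<close>

definition torus_coeff :: "(real^'d \<Rightarrow> complex) \<Rightarrow> int^'d \<Rightarrow> complex" where
  "torus_coeff H k = (LINT x|torus. H x * cnj (character (of_int_vec k) x))"

lemma borel_measurable_cnj [measurable (raw)]:
  "f \<in> borel_measurable M \<Longrightarrow> (\<lambda>x. cnj (f x)) \<in> borel_measurable M"
  by (rule measurable_compose[OF _ borel_measurable_continuous_onI[OF continuous_on_cnj[OF continuous_on_id]]])

lemma torus_integrable_bounded:
  fixes f :: "real^'d \<Rightarrow> 'b::{banach, second_countable_topology}"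
  assumes [measurable]: "f \<in> borel_measurable borel" and "\<And>x. norm (f x) \<le> B"
  shows "integrable torus f"
proof -
  interpret prob_space "torus :: (real^'d) measure" by (rule prob_space_torus)
  show ?thesis by (rule integrable_const_bound[of _ B]) (use assms in auto)
qed

lemma integral_torus_character_mult:
  fixes k l :: "int^'d"
  shows "(LINT x|torus. character (of_int_vec k) x * cnj (character (of_int_vec l) x)) = of_bool (k = l)"
proof -
  interpret prob_space "torus :: (real^'d) measure" by (rule prob_space_torus)
  have "character (of_int_vec k) x * cnj (character (of_int_vec l) x) = character (of_int_vec (k - l)) x" for x :: "real^'d"
    using character_add_left[of "of_int_vec k" "- of_int_vec l" x]
    by (simp add: character_uminus_left of_int_vec_diff)
  then show ?thesis
    using integral_torus_character[of "k - l"] prob_space by (cases "k = l") simp_all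
qed

text \<open>Expansion of the square by orthonormality. With \<open>a\<close> the coefficients it
  yields Bessel's inequality; with arbitrary \<open>a\<close> it yields the minimality of the
  Fourier partial sum, which the Parseval argument uses.\<close>

lemma torus_norm_diff_trig_poly:
  fixes H :: "real^'d \<Rightarrow> complex"
  assumes [measurable]: "H \<in> borel_measurable borel" and int: "integrable torus (\<lambda>x. (norm (H x))\<^sup>2)"
    and F: "finite F"
  shows "(LINT x|torus. (norm (H x - (\<Sum>k\<in>F. a k * character (of_int_vec k) x)))\<^sup>2) =
    (LINT x|torus. (norm (H x))\<^sup>2) - (\<Sum>k\<in>F. (norm (torus_coeff H k))\<^sup>2)
      + (\<Sum>k\<in>F. (norm (a k - torus_coeff H k))\<^sup>2)"
proof -
  interpret prob_space "torus :: (real^'d) measure" by (rule prob_space_torus)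
  let ?e = "\<lambda>k. character (of_int_vec k)"
  let ?c = "torus_coeff H"
  have intH: "integrable torus H"
  proof -
    have "integrable torus (\<lambda>x. norm (H x))"
      by (rule square_integrable_imp_integrable) (use int in auto)
    then show ?thesis by (simp add: integrable_norm_iff)
  qed
  have intHe: "integrable torus (\<lambda>x. H x * cnj (?e k x))" "integrable torus (\<lambda>x. cnj (H x) * ?e k x)" for k
    by (rule Bochner_Integration.integrable_bound[OF intH], measurable, simp add: norm_mult)+
  have intee: "integrable torus (\<lambda>x. ?e k x * cnj (?e l x))" for k l :: "int^'d"
    by (rule torus_integrable_bounded[where B=1]) (auto simp: norm_mult)
  have intHH: "integrable torus (\<lambda>x. H x * cnj (H x))"
    unfolding complex_norm_square[symmetric] by (rule integrable_of_real[OF int])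
  have c: "(LINT x|torus. cnj (H x) * ?e k x) = cnj (?c k)" for k
    using Bochner_Integration.integral_cnj[of torus "\<lambda>x. H x * cnj (?e k x)"] by (simp add: torus_coeff_def)
  have "complex_of_real (LINT x|torus. (norm (H x - (\<Sum>k\<in>F. a k * ?e k x)))\<^sup>2) =
     (LINT x|torus. complex_of_real ((norm (H x - (\<Sum>k\<in>F. a k * ?e k x)))\<^sup>2))"
    by (rule integral_complex_of_real[symmetric])
  also have "\<dots> = (LINT x|torus. H x * cnj (H x) - (\<Sum>k\<in>F. cnj (a k) * (H x * cnj (?e k x)))
     - (\<Sum>k\<in>F. a k * (cnj (H x) * ?e k x)) + (\<Sum>k\<in>F. \<Sum>l\<in>F. (a k * cnj (a l)) * (?e k x * cnj (?e l x))))"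
    unfolding complex_norm_square
    by (intro Bochner_Integration.integral_cong refl)
       (simp add: algebra_simps sum_distrib_left sum_distrib_right sum_product, rule sum.swap)
  also have "\<dots> = (LINT x|torus. H x * cnj (H x)) - (\<Sum>k\<in>F. cnj (a k) * ?c k)
     - (\<Sum>k\<in>F. a k * cnj (?c k)) + (\<Sum>k\<in>F. \<Sum>l\<in>F. (a k * cnj (a l)) * of_bool (k = l))"
    by (simp add: intHe intee intHH c Bochner_Integration.integral_sum Bochner_Integration.integrable_sum
       integral_torus_character_mult torus_coeff_def[symmetric])
  also have "(\<Sum>k\<in>F. \<Sum>l\<in>F. (a k * cnj (a l)) * of_bool (k = l)) = (\<Sum>k\<in>F. a k * cnj (a k))"
    using F by (intro sum.cong refl) (simp add: of_bool_def if_distrib[of "\<lambda>x. _ * x"] sum.delta' cong: if_cong)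
  also have "(LINT x|torus. H x * cnj (H x)) = complex_of_real (LINT x|torus. (norm (H x))\<^sup>2)"
    by (simp only: complex_norm_square[symmetric] integral_complex_of_real)
  finally have "complex_of_real (LINT x|torus. (norm (H x - (\<Sum>k\<in>F. a k * ?e k x)))\<^sup>2) =
     complex_of_real (LINT x|torus. (norm (H x))\<^sup>2) - (\<Sum>k\<in>F. cnj (a k) * ?c k)
     - (\<Sum>k\<in>F. a k * cnj (?c k)) + (\<Sum>k\<in>F. a k * cnj (a k))" .
  also have "\<dots> = complex_of_real ((LINT x|torus. (norm (H x))\<^sup>2) - (\<Sum>k\<in>F. (norm (?c k))\<^sup>2)
      + (\<Sum>k\<in>F. (norm (a k - ?c k))\<^sup>2))"
    by (simp add: complex_norm_square algebra_simps sum.distrib sum_subtractf del: of_real_power)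
  finally show ?thesis by (simp only: of_real_eq_iff)
qed

lemma torus_bessel:
  fixes H :: "real^'d \<Rightarrow> complex"
  assumes [measurable]: "H \<in> borel_measurable borel" and int: "integrable torus (\<lambda>x. (norm (H x))\<^sup>2)"
  shows "(\<integral>\<^sup>+k. ennreal ((norm (torus_coeff H k))\<^sup>2) \<partial>count_space UNIV) \<le>
    ennreal (LINT x|torus. (norm (H x))\<^sup>2)"
proof -
  have fin: "(\<Sum>k\<in>F. (norm (torus_coeff H k))\<^sup>2) \<le> (LINT x|torus. (norm (H x))\<^sup>2)" if "finite F" for F
  proof -
    have "0 \<le> (LINT x|torus. (norm (H x - (\<Sum>k\<in>F. torus_coeff H k * character (of_int_vec k) x)))\<^sup>2)"
      by simp
    then show ?thesis
      by (subst (asm) torus_norm_diff_trig_poly[OF assms that]) simp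
  qed
  then show ?thesis
    by (intro nn_integral_count_space_le) (simp add: ennreal_leI)
qed

section \<open>Trigonometric approximation and Parseval\<close>

text \<open>In this form closure under products and sums follows by short inductions; the normal
  form with one coefficient per frequency, on which the L2 identity operates, is recovered in
  \<open>trig_poly_as_sum\<close>.\<close>

inductive trig_poly :: "(real^'d \<Rightarrow> complex) \<Rightarrow> bool" where
  monomial: "trig_poly (\<lambda>x. a * character (of_int_vec k) x)"
| add: "trig_poly p \<Longrightarrow> trig_poly q \<Longrightarrow> trig_poly (\<lambda>x. p x + q x)"

lemma trig_poly_const: "trig_poly (\<lambda>x. a)"
  using trig_poly.monomial[of a 0] by simp

lemma trig_poly_mult:
  assumes "trig_poly p" "trig_poly q"
  shows "trig_poly (\<lambda>x. p x * q x)"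
  using assms(1)
proof induction
  case (monomial a k)
  show ?case using assms(2)
  proof induction
    case (monomial b l)
    have "(\<lambda>x. a * character (of_int_vec k) x * (b * character (of_int_vec l) x)) =
        (\<lambda>x. (a * b) * character (of_int_vec (k + l)) x)"
      by (simp add: of_int_vec_add character_add_left fun_eq_iff)
    then show ?case by (simp only: trig_poly.monomial)
  next
    case (add p q)
    then show ?case using trig_poly.add by (simp add: distrib_left)
  qed
next
  case (add p q)
  then show ?case using trig_poly.add by (simp add: distrib_right)
qed

lemma trig_poly_sum:
  "(\<And>i. i \<in> I \<Longrightarrow> trig_poly (p i)) \<Longrightarrow> trig_poly (\<lambda>x. \<Sum>i\<in>I. p i x)"
  by (induction I rule: infinite_finite_induct) (auto intro: trig_poly_const trig_poly.add)

lemma trig_poly_as_sum: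
  assumes "trig_poly p"
  shows "\<exists>F a. finite F \<and> (\<forall>x. p x = (\<Sum>k\<in>F. a k * character (of_int_vec k) x))"
  using assms
proof induction
  case (monomial a k)
  show ?case by (intro exI[of _ "{k}"] exI[of _ "\<lambda>_. a"]) simp
next
  case (add p q)
  then obtain F a G b where F: "finite F" "\<And>x. p x = (\<Sum>k\<in>F. a k * character (of_int_vec k) x)"
    and G: "finite G" "\<And>x. q x = (\<Sum>k\<in>G. b k * character (of_int_vec k) x)" by blast
  define c where "c k = (if k \<in> F then a k else 0) + (if k \<in> G then b k else 0)" for k
  have "p x + q x = (\<Sum>k\<in>F \<union> G. c k * character (of_int_vec k) x)" for x
  proof -
    have "p x = (\<Sum>k\<in>F \<union> G. (if k \<in> F then a k else 0) * character (of_int_vec k) x)"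
      unfolding F(2) using F(1) G(1) by (intro sum.mono_neutral_cong_left) auto
    moreover have "q x = (\<Sum>k\<in>F \<union> G. (if k \<in> G then b k else 0) * character (of_int_vec k) x)"
      unfolding G(2) using F(1) G(1) by (intro sum.mono_neutral_cong_left) auto
    ultimately show ?thesis by (simp add: c_def sum.distrib distrib_right)
  qed
  then show ?case using F(1) G(1) by (intro exI[of _ "F \<union> G"] exI[of _ c]) auto
qed

text \<open>
  Stone-Weierstrass is applied to the image of \<open>torus_emb\<close>: linear functionals on the ambient space
  pull back to trigonometric polynomials.
\<close>

definition torus_emb :: "real^'d \<Rightarrow> complex^'d" where
  "torus_emb x = (\<chi> i. cis (2 * pi * x $ i))"

lemma character_axis: "character (of_int_vec (axis i 1)) x = cis (2 * pi * x $ i)"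
proof -
  have "of_int_vec (axis i 1) = axis i (1::real)" by (simp add: vec_eq_iff axis_def)
  then show ?thesis by (simp add: character_def inner_axis')
qed

lemma trig_poly_real_polynomial:
  fixes P :: "complex^'d \<Rightarrow> real"
  assumes "real_polynomial_function P"
  shows "trig_poly (\<lambda>x. complex_of_real (P (torus_emb x)))"
  using assms
proof induction
  case (linear f)
  interpret bounded_linear f by fact
  have dec: "z = (\<Sum>i\<in>UNIV. Re (z $ i) *\<^sub>R axis i 1 + Im (z $ i) *\<^sub>R axis i \<i>)" for z :: "complex^'d"
  proof (rule vec_eq_iff[THEN iffD2], rule allI)
    fix j
    have "(\<Sum>i\<in>UNIV. Re (z $ i) *\<^sub>R axis i 1 + Im (z $ i) *\<^sub>R axis i \<i>) $ j =
        (\<Sum>i\<in>UNIV. if i = j then z $ i else 0)"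
      unfolding sum_component
      by (intro sum.cong refl) (auto simp: axis_def complex_eq_iff)
    then show "z $ j = (\<Sum>i\<in>UNIV. Re (z $ i) *\<^sub>R axis i 1 + Im (z $ i) *\<^sub>R axis i \<i>) $ j" by simp
  qed
  have fz: "f z = (\<Sum>i\<in>UNIV. Re (z $ i) * f (axis i 1) + Im (z $ i) * f (axis i \<i>))" for z
    by (subst dec[of z]) (simp add: sum add scaleR)
  \<comment> \<open>Real and imaginary part of \<open>cis t\<close> are combinations of
    \<open>cis t\<close> and its conjugate, and these are characters at opposite unit
    frequencies.\<close>
  have cs: "complex_of_real (Re (cis t) * a + Im (cis t) * b) =
     (of_real a / 2 - \<i> * of_real b / 2) * cis t + (of_real a / 2 + \<i> * of_real b / 2) * cnj (cis t)" for t a b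
    by (simp add: complex_eq_iff)
  have eq: "complex_of_real (f (torus_emb x)) = (\<Sum>i\<in>UNIV.
      (of_real (f (axis i 1)) / 2 - \<i> * of_real (f (axis i \<i>)) / 2) * character (of_int_vec (axis i 1)) x +
      (of_real (f (axis i 1)) / 2 + \<i> * of_real (f (axis i \<i>)) / 2) * character (of_int_vec (- axis i 1)) x)" for x
    by (subst fz) (simp only: torus_emb_def vec_lambda_beta of_real_sum cs character_axis
      of_int_vec_uminus character_uminus_left)
  show ?case unfolding eq by (intro trig_poly_sum trig_poly.intros)
next
  case (const c)
  show ?case by (rule trig_poly_const)
next
  case (add f g)
  then show ?case using trig_poly.add by simp
next
  case (mult f g)
  then show ?case using trig_poly_mult by simp
qed

section \<open>Uniform approximation of periodic functions\<close>

lemma torus_emb_eq: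
  assumes "torus_emb x = torus_emb y"
  obtains m where "y = x + of_int_vec m"
proof -
  have "\<exists>n::int. y $ i = x $ i + n" for i
  proof -
    have "cis (2 * pi * x $ i) = cis (2 * pi * y $ i)"
      using assms by (simp add: torus_emb_def vec_eq_iff)
    then have "sin (2 * pi * x $ i) = sin (2 * pi * y $ i) \<and> cos (2 * pi * x $ i) = cos (2 * pi * y $ i)"
      by (simp add: complex_eq_iff)
    then obtain n :: int where "2 * pi * y $ i = 2 * pi * x $ i + 2 * pi * n"
      by (metis sin_cos_eq_iff)
    then have "2 * pi * y $ i = 2 * pi * (x $ i + n)" by (simp add: algebra_simps)
    then have "y $ i = x $ i + n" by simp
    then show ?thesis by blast
  qed
  then obtain m where "\<And>i. y $ i = x $ i + real_of_int (m i)" by metis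
  then have "y = x + of_int_vec (vec_lambda m)" by (simp add: vec_eq_iff)
  then show ?thesis by (rule that)
qed

lemma torus_emb_periodic: "torus_emb (x + of_int_vec m) = torus_emb x"
  by (simp add: torus_emb_def vec_eq_iff distrib_left cis_mult[symmetric] cis_multiple_2pi)

lemma periodic_in_cube:
  assumes "\<And>x m. h (x + of_int_vec m) = h (x :: real^'d)"
  obtains y where "y \<in> cbox 0 1" "h y = h x" "torus_emb y = torus_emb x"
proof -
  obtain m where m: "x - of_int_vec m \<in> (unit_cell :: (real^'d) set)"
    using unit_cell_translate_ex1[of x] by blast
  then have "x - of_int_vec m \<in> cbox 0 1" by (auto simp: unit_cell_def mem_box_cart less_imp_le)
  moreover have "h (x - of_int_vec m) = h x"
    using assms[of "x - of_int_vec m" m] by simp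
  moreover have "torus_emb (x - of_int_vec m) = torus_emb x"
    using torus_emb_periodic[of "x - of_int_vec m" m] by simp
  ultimately show ?thesis by (rule that)
qed

lemma periodic_trig_approx:
  fixes h :: "real^'d \<Rightarrow> real"
  assumes cont: "continuous_on UNIV h" and per: "\<And>x m. h (x + of_int_vec m) = h x" and "e > 0"
  obtains F a where "finite F" "\<And>x. norm (complex_of_real (h x) - (\<Sum>k\<in>F. a k * character (of_int_vec k) x)) < e"
proof -
  define T where "T = torus_emb ` cbox 0 (1::real^'d)"
  \<comment> \<open>\<open>g\<close> is \<open>h\<close> carried over to the image of the embedding.
    \<open>inv_into\<close> picks an arbitrary preimage in the cube; two preimages differ by an
    integer vector, so periodicity makes the choice harmless.\<close>
  define g where "g z = h (inv_into (cbox 0 1) torus_emb z)" for z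
  have contE: "continuous_on S (torus_emb :: real^'d \<Rightarrow> complex^'d)" for S
    unfolding torus_emb_def cis_conv_exp by (intro continuous_intros)
  have g: "g (torus_emb x) = h x" for x
  proof -
    obtain y where y: "y \<in> cbox 0 1" "h y = h x" "torus_emb y = torus_emb x"
      using periodic_in_cube[of h x] per by blast
    then have "torus_emb x \<in> torus_emb ` cbox 0 (1::real^'d)" by (metis imageI)
    then have "torus_emb (inv_into (cbox 0 1) torus_emb (torus_emb x)) = torus_emb x"
      by (rule f_inv_into_f)
    then show ?thesis unfolding g_def using per by (metis torus_emb_eq)
  qed
  have "compact T" unfolding T_def by (intro compact_continuous_image contE compact_cbox)
  moreover have "continuous_on T g"
  \<comment> \<open>Continuity of \<open>g\<close> rests on compactness: the preimage of a closed
    set under \<open>g\<close> is the image under \<open>torus_emb\<close> of a compact part of the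
    cube.\<close>
  proof (subst continuous_on_closed_vimage)
    show "closed T" using \<open>compact T\<close> by (rule compact_imp_closed)
    show "\<forall>B. closed B \<longrightarrow> closed (g -` B \<inter> T)"
    proof (intro allI impI)
      fix B :: "real set" assume "closed B"
      have "g -` B \<inter> T = torus_emb ` (cbox 0 1 \<inter> h -` B)"
        by (auto simp: T_def g)
      moreover have "closed (h -` B)" using cont \<open>closed B\<close> by (simp add: continuous_on_closed_vimage)
      then have "compact (torus_emb ` (cbox 0 1 \<inter> h -` B))"
        by (intro compact_continuous_image contE compact_Int_closed compact_cbox)
      ultimately show "closed (g -` B \<inter> T)" by (simp add: compact_imp_closed)
    qed
  qed
  ultimately obtain P where P: "real_polynomial_function P" "\<And>z. z \<in> T \<Longrightarrow> \<bar>g z - P z\<bar> < e"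
    using Stone_Weierstrass_real_polynomial_function[OF _ _ \<open>e > 0\<close>] by metis
  obtain F a where F: "finite F" "\<And>x. complex_of_real (P (torus_emb x)) = (\<Sum>k\<in>F. a k * character (of_int_vec k) x)"
    using trig_poly_as_sum[OF trig_poly_real_polynomial[OF P(1)]] by blast
  have "norm (complex_of_real (h x) - (\<Sum>k\<in>F. a k * character (of_int_vec k) x)) < e" for x
  proof -
    obtain y where y: "y \<in> cbox 0 1" "h y = h x" "torus_emb y = torus_emb x"
      using periodic_in_cube[of h x] per by blast
    then have "\<bar>g (torus_emb x) - P (torus_emb x)\<bar> < e"
      by (intro P(2)) (metis T_def imageI)
    then show ?thesis unfolding F(2)[symmetric] g of_real_diff[symmetric] norm_of_real .
  qed
  with F(1) show ?thesis by (rule that)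
qed

text \<open>The half of Parseval that Bessel does not give. By uniform density some trigonometric
  polynomial is within \<open>sqrt e\<close> of \<open>h\<close>, hence within \<open>e\<close> in
  squared mean, and the Fourier partial sum over the same frequencies is at least as close. The
  frequency 0 carries the mean and is split off.\<close>

lemma torus_variance_le:
  fixes h :: "real^'d \<Rightarrow> real"
  assumes cont: "continuous_on UNIV h" and per: "\<And>x m. h (x + of_int_vec m) = h x"
  shows "(\<integral>\<^sup>+x. ennreal ((h x - (LINT x|torus. h x))\<^sup>2) \<partial>torus) \<le>
    (\<integral>\<^sup>+k. ennreal ((norm (torus_coeff (\<lambda>x. complex_of_real (h x)) k))\<^sup>2) \<partial>count_space (UNIV - {0}))"
    (is "?L \<le> ?R")
proof -
  interpret prob_space "torus :: (real^'d) measure" by (rule prob_space_torus)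
  define H where "H x = complex_of_real (h x)" for x
  have [measurable]: "h \<in> borel_measurable borel" using cont by (rule borel_measurable_continuous_onI)
  then have [measurable]: "H \<in> borel_measurable borel" unfolding H_def by measurable
  have "bounded (h ` cbox 0 1)"
    by (intro compact_imp_bounded compact_continuous_image compact_cbox continuous_on_subset[OF cont]) auto
  then obtain C where C: "\<And>x. x \<in> cbox 0 1 \<Longrightarrow> norm (h x) \<le> C" by (auto simp: bounded_iff)
  have C: "norm (h x) \<le> C" for x
    using periodic_in_cube[of h x] per C by metis
  have C2: "(norm (h x))\<^sup>2 \<le> C\<^sup>2" for x by (rule power_mono[OF C norm_ge_zero])
  have intH2: "integrable torus (\<lambda>x. (norm (H x))\<^sup>2)"
    by (rule torus_integrable_bounded[where B="C\<^sup>2"])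
       (use C2 in \<open>auto simp: H_def\<close>)
  have c0: "torus_coeff H 0 = complex_of_real (LINT x|torus. h x)"
    unfolding torus_coeff_def H_def by simp
  let ?c = "torus_coeff H"
  have "integrable torus (\<lambda>x. (h x - (LINT x|torus. h x))\<^sup>2)"
  proof (rule torus_integrable_bounded[where B="(C + \<bar>LINT x|torus. h x\<bar>)\<^sup>2"])
    fix x
    have "\<bar>h x - (LINT x|torus. h x)\<bar> \<le> C + \<bar>LINT x|torus. h x\<bar>"
      using C[of x] by simp
    from power_mono[OF this, of 2]
    show "norm ((h x - (LINT x|torus. h x))\<^sup>2) \<le> (C + \<bar>LINT x|torus. h x\<bar>)\<^sup>2" by simp
  qed simp
  then have "?L = ennreal (LINT x|torus. (h x - (LINT x|torus. h x))\<^sup>2)"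
    by (intro nn_integral_eq_integral) auto
  also have "(LINT x|torus. (h x - (LINT x|torus. h x))\<^sup>2) =
      (LINT x|torus. (norm (H x - (\<Sum>k\<in>{0}. ?c k * character (of_int_vec k) x)))\<^sup>2)"
    by (simp add: c0 H_def norm_of_real flip: of_real_diff)
  also have "\<dots> = (LINT x|torus. (norm (H x))\<^sup>2) - (norm (?c 0))\<^sup>2"
    by (subst torus_norm_diff_trig_poly[OF _ intH2]) auto
  also have "ennreal \<dots> \<le> ?R"
  proof (rule ennreal_le_epsilon)
    fix e :: real assume "e > 0"
    then have "sqrt e > 0" by simp
    then obtain F0 a0 where F0: "finite F0"
      "\<And>x. norm (complex_of_real (h x) - (\<Sum>k\<in>F0. a0 k * character (of_int_vec k) x)) < sqrt e"
      using periodic_trig_approx[OF cont per] by blast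
    \<comment> \<open>The frequency 0 is added so that the mean can be separated from the partial
      sum; if it is new, its coefficient in \<open>a\<close> is 0.\<close>
    define F where "F = insert 0 F0"
    define a where "a k = (if k \<in> F0 then a0 k else 0)" for k
    have F: "finite F" using F0 by (simp add: F_def)
    have "(\<Sum>k\<in>F0. a0 k * character (of_int_vec k) x) = (\<Sum>k\<in>F. a k * character (of_int_vec k) x)" for x :: "real^'d"
      unfolding F_def using F0(1) by (intro sum.mono_neutral_cong_left) (auto simp: a_def)
    with F0 have b: "norm (H x - (\<Sum>k\<in>F. a k * character (of_int_vec k) x)) < sqrt e" for x
      by (simp add: H_def)
    have "(LINT x|torus. (norm (H x))\<^sup>2) - (\<Sum>k\<in>F. (norm (?c k))\<^sup>2) \<le>
        (LINT x|torus. (norm (H x - (\<Sum>k\<in>F. a k * character (of_int_vec k) x)))\<^sup>2)"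
      by (subst torus_norm_diff_trig_poly[OF _ intH2 F]) (auto simp: sum_nonneg)
    also have "\<dots> \<le> e"
    proof (rule integral_le_const)
      have bb: "(norm (H x - (\<Sum>k\<in>F. a k * character (of_int_vec k) x)))\<^sup>2 \<le> e" for x
        using power_mono[OF less_imp_le[OF b[of x]], of 2] \<open>e > 0\<close> by simp
      then show "AE x in torus. (norm (H x - (\<Sum>k\<in>F. a k * character (of_int_vec k) x)))\<^sup>2 \<le> e" by simp
      show "integrable torus (\<lambda>x. (norm (H x - (\<Sum>k\<in>F. a k * character (of_int_vec k) x)))\<^sup>2)"
        by (rule torus_integrable_bounded[where B=e]) (use bb in auto)
    qed
    finally have "(LINT x|torus. (norm (H x))\<^sup>2) - (norm (?c 0))\<^sup>2 \<le> (\<Sum>k\<in>F - {0}. (norm (?c k))\<^sup>2) + e"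
      using F by (simp add: F_def sum.insert_remove algebra_simps)
    then have "ennreal ((LINT x|torus. (norm (H x))\<^sup>2) - (norm (?c 0))\<^sup>2) \<le>
       (\<Sum>k\<in>F - {0}. ennreal ((norm (?c k))\<^sup>2)) + ennreal e"
      using \<open>e > 0\<close> by (subst sum_ennreal) (auto simp: sum_nonneg simp flip: ennreal_plus intro!: ennreal_leI)
    also have "(\<Sum>k\<in>F - {0}. ennreal ((norm (?c k))\<^sup>2)) = (\<integral>\<^sup>+k. ennreal ((norm (?c k))\<^sup>2) \<partial>count_space (F - {0}))"
      using F by (simp add: nn_integral_count_space_finite)
    also have "\<dots> \<le> (\<integral>\<^sup>+k. ennreal ((norm (?c k))\<^sup>2) \<partial>count_space (UNIV - {0}))"
      by (subst (1 2) nn_integral_count_space_indicator) (auto intro!: nn_integral_mono simp: indicator_def)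
    also have "\<dots> = ?R" by (simp add: H_def[abs_def])
    finally show "ennreal ((LINT x|torus. (norm (H x))\<^sup>2) - (norm (?c 0))\<^sup>2) \<le> ?R + ennreal e"
      by (simp add: add_right_mono)
  qed
  finally show ?thesis .
qed

section \<open>Fourier transform and Poisson summation\<close>

text \<open>For functions supported in the cube this is the Fourier transform, by
  \<open>integral_supported_cube\<close>. For a weak derivative that is merely square integrable,
  the restriction to the cube makes the integral converge.\<close>

definition torus_fourier :: "(real^'d \<Rightarrow> real) \<Rightarrow> real^'d \<Rightarrow> complex" where
  "torus_fourier g \<xi> = (LINT x|torus. complex_of_real (g x) * cnj (character \<xi> x))"

lemma torus_fourier_measurable [measurable]:
  fixes g :: "real^'d \<Rightarrow> real"
  assumes [measurable]: "g \<in> borel_measurable borel"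
  shows "torus_fourier g \<in> borel_measurable borel"
proof -
  interpret prob_space "torus :: (real^'d) measure" by (rule prob_space_torus)
  have "(\<lambda>p::(real^'d) \<times> (real^'d). cnj (character (fst p) (snd p))) \<in> borel_measurable borel"
    unfolding character_def cis_conv_exp
    by (intro borel_measurable_continuous_onI continuous_intros)
  then have "(\<lambda>p::(real^'d) \<times> (real^'d). cnj (character (fst p) (snd p))) \<in> borel_measurable (borel \<Otimes>\<^sub>M borel)"
    by (simp add: borel_prod)
  then have [measurable]: "(\<lambda>(\<xi>, x). cnj (character \<xi> x)) \<in> borel_measurable (borel \<Otimes>\<^sub>M (borel :: (real^'d) measure))"
    by (simp add: case_prod_beta)
  have "(\<lambda>(\<xi>, x). complex_of_real (g x) * cnj (character \<xi> x)) \<in> borel_measurable (borel \<Otimes>\<^sub>M (torus :: (real^'d) measure))"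
    by measurable
  from borel_measurable_lebesgue_integral[OF this] show ?thesis
    unfolding torus_fourier_def[abs_def] by simp
qed

text \<open>At \<open>t + k\<close> the transform of \<open>g\<close> is the \<open>k\<close>-th
  coefficient of \<open>g\<close> times the conjugate character at \<open>t\<close>, a function of
  the same modulus as \<open>g\<close>. Bessel bounds the sum over \<open>k\<close> uniformly in
  \<open>t\<close>, and integrating over the cell costs nothing because its measure is 1.\<close>

lemma torus_fourier_square_le:
  fixes g :: "real^'d \<Rightarrow> real"
  assumes [measurable]: "g \<in> borel_measurable borel" and int: "integrable torus (\<lambda>x. (g x)\<^sup>2)"
  shows "(\<integral>\<^sup>+\<xi>. ennreal ((norm (torus_fourier g \<xi>))\<^sup>2) \<partial>lborel) \<le> ennreal (LINT x|torus. (g x)\<^sup>2)"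
proof -
  interpret prob_space "torus :: (real^'d) measure" by (rule prob_space_torus)
  have coeff: "torus_fourier g (t + of_int_vec k) = torus_coeff (\<lambda>x. complex_of_real (g x) * cnj (character t x)) k" for t k
    by (simp add: torus_fourier_def torus_coeff_def character_add_left mult.assoc)
  have "(\<integral>\<^sup>+\<xi>. ennreal ((norm (torus_fourier g \<xi>))\<^sup>2) \<partial>lborel) =
    (\<integral>\<^sup>+t. \<integral>\<^sup>+k. ennreal ((norm (torus_fourier g (t + of_int_vec k)))\<^sup>2) \<partial>count_space UNIV \<partial>torus)"
    by (rule nn_integral_unfold_lattice) measurable
  also have "\<dots> \<le> (\<integral>\<^sup>+t. ennreal (LINT x|torus. (g x)\<^sup>2) \<partial>(torus :: (real^'d) measure))"
  proof (rule nn_integral_mono)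
    fix t :: "real^'d"
    have nrm: "(norm (complex_of_real (g x) * cnj (character t x)))\<^sup>2 = (g x)\<^sup>2" for x
      by (simp add: norm_mult)
    show "(\<integral>\<^sup>+k. ennreal ((norm (torus_fourier g (t + of_int_vec k)))\<^sup>2) \<partial>count_space UNIV)
        \<le> ennreal (LINT x|torus. (g x)\<^sup>2)"
      unfolding coeff using torus_bessel[of "\<lambda>x. complex_of_real (g x) * cnj (character t x)"] int
      unfolding nrm by simp
  qed
  also have "\<dots> = ennreal (LINT x|torus. (g x)\<^sup>2)"
    by (subst nn_integral_const) (simp add: emeasure_space_1[simplified])
  finally show ?thesis .
qed

section \<open>Periodization of functions with bounded support\<close>

definition periodization :: "(real^'d \<Rightarrow> real) \<Rightarrow> real^'d \<Rightarrow> real" where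
  "periodization \<phi> v = (\<Sum>\<^sub>\<infinity>m\<in>UNIV. \<phi> (of_int_vec m + v))"

text \<open>One finite set serves all shifts in a ball, so the periodization is locally a finite sum
  and inherits continuity.\<close>

lemma finite_lattice_translates:
  fixes \<phi> :: "real^'d \<Rightarrow> real"
  assumes "bounded {x. \<phi> x \<noteq> 0}"
  obtains F where "finite F" "\<And>v m. norm v \<le> R \<Longrightarrow> m \<notin> F \<Longrightarrow> \<phi> (of_int_vec m + v) = 0"
proof -
  obtain K where K: "\<And>x. \<phi> x \<noteq> 0 \<Longrightarrow> norm x \<le> K"
    using assms by (auto simp: bounded_iff)
  let ?F = "{m::int^'d. \<forall>i. - \<lceil>K + R\<rceil> \<le> m $ i \<and> m $ i \<le> \<lceil>K + R\<rceil>}"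
  show ?thesis
  proof (rule that)
    show "finite ?F" by (rule finite_int_vec_box)
    fix v :: "real^'d" and m assume v: "norm v \<le> R" and m: "m \<notin> ?F"
    show "\<phi> (of_int_vec m + v) = 0"
    proof (rule ccontr)
      assume "\<phi> (of_int_vec m + v) \<noteq> 0"
      then have "norm (of_int_vec m + v) \<le> K" by (rule K)
      then have "norm (of_int_vec m :: real^'d) \<le> K + R"
        using v norm_triangle_ineq4[of "of_int_vec m + v" v] by simp
      then have "\<bar>real_of_int (m $ i)\<bar> \<le> K + R" for i
        using component_le_norm_cart[of "of_int_vec m :: real^'d" i] by simp
      then have "- \<lceil>K + R\<rceil> \<le> m $ i \<and> m $ i \<le> \<lceil>K + R\<rceil>" for i
        by (smt (verit) le_of_int_ceiling of_int_le_iff of_int_minus)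
      then show False using m by simp
    qed
  qed
qed

lemma periodization_eq_sum:
  assumes "finite F" "\<And>m. m \<notin> F \<Longrightarrow> \<phi> (of_int_vec m + v) = 0"
  shows "periodization \<phi> v = (\<Sum>m\<in>F. \<phi> (of_int_vec m + v))"
  unfolding periodization_def
  by (subst infsum_cong_neutral[where T=F and g="\<lambda>m. \<phi> (of_int_vec m + v)"]) (use assms in \<open>auto simp: infsum_finite\<close>)

lemma continuous_periodization:
  fixes \<phi> :: "real^'d \<Rightarrow> real"
  assumes "continuous_on UNIV \<phi>" "bounded {x. \<phi> x \<noteq> 0}"
  shows "continuous_on UNIV (periodization \<phi>)"
proof -
  have "continuous_on (ball 0 R) (periodization \<phi>)" for R
  proof -
    obtain F where F: "finite F" "\<And>v m. norm v \<le> R \<Longrightarrow> m \<notin> F \<Longrightarrow> \<phi> (of_int_vec m + v) = 0"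
      using finite_lattice_translates[OF assms(2)] by blast
    have "continuous_on (ball 0 R) (\<lambda>v. \<Sum>m\<in>F. \<phi> (of_int_vec m + v))"
      by (intro continuous_intros continuous_on_compose2[OF assms(1)]) auto
    then show ?thesis
      by (rule continuous_on_eq) (use F in \<open>auto intro!: periodization_eq_sum[symmetric]\<close>)
  qed
  then have "continuous_on (\<Union>R. ball 0 R) (periodization \<phi>)"
    by (intro continuous_on_open_UN) auto
  moreover have "(\<Union>R. ball 0 R) = (UNIV :: (real^'d) set)"
    by (auto intro: gt_ex)
  ultimately show ?thesis by simp
qed

lemma periodization_periodic: "periodization \<phi> (v + of_int_vec k) = periodization \<phi> v"
proof -
  have "periodization \<phi> v = (\<Sum>\<^sub>\<infinity>m\<in>UNIV. \<phi> (of_int_vec (m + k) + v))"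
    unfolding periodization_def
    by (rule infsum_reindex_bij_betw[symmetric, of "\<lambda>m. m + k" UNIV UNIV "\<lambda>m. \<phi> (of_int_vec m + v)"])
       (auto intro!: bij_betwI[where g="\<lambda>m. m - k"])
  then show ?thesis by (simp add: periodization_def of_int_vec_add ac_simps)
qed

text \<open>Poisson summation at the level of coefficients: characters at integer frequencies do not
  see integer translations, so unfolding the integral over space collects the translates of \<phi>
  into its periodization.\<close>

lemma torus_coeff_periodization:
  fixes \<phi> :: "real^'d \<Rightarrow> real"
  assumes cont: "continuous_on UNIV \<phi>" and bdd: "bounded {x. \<phi> x \<noteq> 0}" and int: "integrable lborel \<phi>"
  shows "torus_coeff (\<lambda>x. complex_of_real (periodization \<phi> x)) k =
    (LINT x|lborel. complex_of_real (\<phi> x) * cnj (character (of_int_vec k) x))"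
proof -
  let ?e = "character (of_int_vec k)"
  have [measurable]: "\<phi> \<in> borel_measurable borel" using cont by (rule borel_measurable_continuous_onI)
  have [measurable]: "periodization \<phi> \<in> borel_measurable borel"
    using continuous_periodization[OF cont bdd] by (rule borel_measurable_continuous_onI)
  \<comment> \<open>The coordinates of a point of the cell lie in [0,1), so its l1 norm, and with it
    the Euclidean norm, is at most the dimension.\<close>
  define N where "N = real CARD('d)"
  have N: "norm x \<le> N" if "x \<in> unit_cell" for x :: "real^'d"
  proof -
    have "norm x \<le> (\<Sum>i\<in>UNIV. \<bar>x $ i\<bar>)" by (rule norm_le_l1_cart)
    also have "\<dots> \<le> (\<Sum>i\<in>(UNIV::'d set). 1)" using that by (intro sum_mono) (auto simp: unit_cell_def less_imp_le)
    finally show ?thesis by (simp add: N_def)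
  qed
  obtain F where F: "finite F" "\<And>v m. norm v \<le> N \<Longrightarrow> m \<notin> F \<Longrightarrow> \<phi> (of_int_vec m + v) = 0"
    using finite_lattice_translates[OF bdd] by blast
  have "integrable lborel (\<lambda>x. complex_of_real (\<phi> x) * cnj (?e x))"
    by (rule Bochner_Integration.integrable_bound[OF int]) (auto simp: norm_mult)
  then have "(LINT x|lborel. complex_of_real (\<phi> x) * cnj (?e x)) =
     (LINT x|torus. (\<Sum>m\<in>F. complex_of_real (\<phi> (x + of_int_vec m)) * cnj (?e (x + of_int_vec m))))"
    using F(1) by (rule integral_unfold_lattice) (use N F(2) in \<open>auto simp: add.commute\<close>)
  also have "\<dots> = (LINT x|torus. complex_of_real (periodization \<phi> x) * cnj (?e x))"
  proof -
    have "indicator unit_cell x *\<^sub>R (\<Sum>m\<in>F. complex_of_real (\<phi> (x + of_int_vec m)) * cnj (?e (x + of_int_vec m)))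
      = indicator unit_cell x *\<^sub>R (complex_of_real (periodization \<phi> x) * cnj (?e x))" for x
    proof (cases "x \<in> unit_cell")
      case True
      then have "periodization \<phi> x = (\<Sum>m\<in>F. \<phi> (x + of_int_vec m))"
        using periodization_eq_sum[of F \<phi> x, OF F(1)] F(2)[OF N] by (simp add: add.commute)
      then show ?thesis by (simp add: character_add_right sum_distrib_right)
    qed simp
    then show ?thesis by (subst (1 2) integral_torus) (measurable, simp only:)
  qed
  finally show ?thesis by (simp add: torus_coeff_def)
qed

lemma continuous_bounded_support_integrable:
  fixes \<phi> :: "real^'d \<Rightarrow> real"
  assumes "continuous_on UNIV \<phi>" "bounded {x. \<phi> x \<noteq> 0}"
  shows "integrable lborel \<phi>"
proof -
  obtain R where R: "\<And>x. \<phi> x \<noteq> 0 \<Longrightarrow> x \<in> cball 0 R"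
    using assms(2) by (auto simp: bounded_iff)
  have "set_integrable lborel (cball 0 R) \<phi>"
    unfolding set_integrable_def
    by (rule borel_integrable_compact) (auto intro: continuous_on_subset[OF assms(1)])
  then have "integrable lborel (\<lambda>x. indicator (cball 0 R) x *\<^sub>R \<phi> x)"
    by (simp add: set_integrable_def)
  also have "(\<lambda>x. indicator (cball 0 R) x *\<^sub>R \<phi> x) = \<phi>"
    using R by (auto simp: fun_eq_iff indicator_def)
  finally show ?thesis .
qed


lemma integral_supported_cube:
  fixes f :: "real^'d \<Rightarrow> real"
  assumes [measurable]: "f \<in> borel_measurable borel" and supp: "\<And>x. x \<notin> cbox 0 1 \<Longrightarrow> f x = 0"
  shows "(LINT x|lborel. complex_of_real (f x) * cnj (character \<xi> x)) = torus_fourier f \<xi>"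
  unfolding torus_fourier_def
  by (subst integral_torus)
     (use AE_unit_cell_iff supp in \<open>auto intro!: integral_cong_AE simp: indicator_def elim!: eventually_mono\<close>)

section \<open>Variance of the quadrature over the shift\<close>

lemma transpose_vector_inner:
  fixes A :: "real^'d^'d"
  shows "x \<bullet> (transpose A *v y) = (A *v x) \<bullet> y"
  by (metis dot_lmul_matrix transpose_matrix_vector inner_commute)

lemma matrix_inv_left:
  fixes A :: "'a::semiring_1^'n^'n"
  assumes "invertible A"
  shows "matrix_inv A ** A = mat 1"
  using someI_ex[OF assms[unfolded invertible_def]] by (simp add: matrix_inv_def)

text \<open>The nodes are the shifted integer lattice mapped by \<open>A\<close>, the inverse
  transpose of \<open>S\<close>, so the rule is the periodization of \<phi>, the composition of
  \<open>f\<close> with \<open>A\<close>, divided by |det S|. The inner product of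
  \<open>S k\<close> with \<open>A x\<close> equals that of \<open>k\<close> with \<open>x\<close>,
  which moves the integer frequency \<open>k\<close> to \<open>S k\<close>, and the Jacobian |det A|
  of the substitution is exactly the normalization. At \<open>k = 0\<close> this says that the rule
  is unbiased over the shift.\<close>

lemma quadrature_variance_le:
  fixes S :: "real^'d^'d"
  assumes S: "invertible S" and cont: "continuous_on UNIV f" and supp: "\<And>x. x \<notin> cbox 0 1 \<Longrightarrow> f x = 0"
  shows "(\<integral>\<^sup>+v. ennreal ((quadrature S v f - (LINT x|lborel. f x))\<^sup>2) \<partial>torus) \<le>
    (\<integral>\<^sup>+k. ennreal ((norm (torus_fourier f (S *v of_int_vec k)))\<^sup>2) \<partial>count_space (UNIV - {0}))"
proof -
  interpret prob_space "torus :: (real^'d) measure" by (rule prob_space_torus)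
  define A where "A = transpose (matrix_inv S)"
  have inv: "matrix_inv S ** S = mat 1" using S by (rule matrix_inv_left)
  have SA: "transpose S ** A = mat 1"
    unfolding A_def matrix_transpose_mul[symmetric] inv by simp
  have TA: "transpose S *v (A *v x) = x" for x
    by (simp add: matrix_vector_mul_assoc SA)
  have "det S * det A = 1"
    using arg_cong[OF SA, of det] by (simp add: det_mul)
  then have dS: "det S \<noteq> 0" and dA: "det A \<noteq> 0" and dSA: "\<bar>det S\<bar> * \<bar>det A\<bar> = 1"
    by (auto simp flip: abs_mult)
  define \<phi> where "\<phi> x = f (A *v x)" for x
  have contA: "continuous_on UNIV \<phi>"
    unfolding \<phi>_def by (intro continuous_on_compose2[OF cont] continuous_intros) auto
  have "{x. \<phi> x \<noteq> 0} \<subseteq> (\<lambda>y. transpose S *v y) ` cbox 0 1"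
  proof
    fix x assume "x \<in> {x. \<phi> x \<noteq> 0}"
    then have "A *v x \<in> cbox 0 1" using supp by (auto simp: \<phi>_def)
    then show "x \<in> (\<lambda>y. transpose S *v y) ` cbox 0 1"
      by (intro image_eqI[of _ _ "A *v x"]) (simp_all only: TA)
  qed
  then have bdd: "bounded {x. \<phi> x \<noteq> 0}"
    by (rule bounded_subset[rotated])
       (intro bounded_linear_image matrix_vector_mul_bounded_linear bounded_cbox)
  have [measurable]: "f \<in> borel_measurable borel" "\<phi> \<in> borel_measurable borel"
    using cont contA by (auto intro: borel_measurable_continuous_onI)
  define h where "h v = 1 / \<bar>det S\<bar> * periodization \<phi> v" for v
  have h: "quadrature S v f = h v" for v
    by (simp add: quadrature_def h_def periodization_def \<phi>_def A_def)
  have conth: "continuous_on UNIV h"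
    unfolding h_def by (intro continuous_intros continuous_periodization contA bdd)
  have perh: "h (v + of_int_vec k) = h v" for v k
    by (simp add: h_def periodization_periodic)
  have coeff: "torus_coeff (\<lambda>x. complex_of_real (h x)) k = torus_fourier f (S *v of_int_vec k)" for k
  proof -
    let ?G = "\<lambda>y. complex_of_real (f y) * cnj (character (S *v of_int_vec k) y)"
    have G: "?G (A *v x) = complex_of_real (\<phi> x) * cnj (character (of_int_vec k) x)" for x
    proof -
      have "(S *v of_int_vec k) \<bullet> (A *v x) = of_int_vec k \<bullet> x"
        by (subst transpose_vector_inner[symmetric]) (simp only: TA)
      then show ?thesis by (simp add: character_def \<phi>_def)
    qed
    have "torus_fourier f (S *v of_int_vec k) = (LINT y|lborel. ?G y)"
      by (rule integral_supported_cube[symmetric]) (use supp in auto)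
    also have "\<dots> = \<bar>det A\<bar> *\<^sub>R (LINT x|lborel. ?G (A *v x))"
      by (rule integral_lborel_matrix[OF dA]) measurable
    also have "\<dots> = \<bar>det A\<bar> *\<^sub>R torus_coeff (\<lambda>x. complex_of_real (periodization \<phi> x)) k"
      unfolding G
      by (subst torus_coeff_periodization[OF contA bdd continuous_bounded_support_integrable[OF contA bdd]]) simp
    also have "\<bar>det A\<bar> = 1 / \<bar>det S\<bar>"
      using dSA dS by (simp add: field_simps)
    finally show ?thesis
      by (simp add: torus_coeff_def h_def scaleR_conv_of_real mult.assoc)
  qed
  have "complex_of_real (LINT x|torus. h x) = torus_coeff (\<lambda>x. complex_of_real (h x)) 0"
    by (simp add: torus_coeff_def)
  also have "\<dots> = (LINT x|lborel. complex_of_real (f x) * cnj (character 0 x))"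
    unfolding coeff by (subst integral_supported_cube) (use supp in auto)
  also have "\<dots> = complex_of_real (LINT x|lborel. f x)" by simp
  finally have "(LINT x|torus. h x) = (LINT x|lborel. f x)" by (simp only: of_real_eq_iff)
  then show ?thesis
    using torus_variance_le[OF conth perh] by (simp add: h coeff)
qed

section \<open>Smooth cutoffs and product test functions\<close>

definition vderiv :: "(real \<Rightarrow> complex) \<Rightarrow> real \<Rightarrow> complex" where
  "vderiv f t = vector_derivative f (at t)"

definition smooth_curve :: "(real \<Rightarrow> complex) \<Rightarrow> bool" where
  "smooth_curve f \<longleftrightarrow> (\<forall>n t. (vderiv ^^ n) f differentiable (at t))"

lemma vderiv_eqI: "(\<And>t. (f has_vector_derivative f' t) (at t)) \<Longrightarrow> vderiv f = f'"
  by (simp add: fun_eq_iff vderiv_def vector_derivative_at)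

text \<open>A class of functions closed under differentiation contains all iterated derivatives of
  its members, so exhibiting such a class avoids formulas for the \<open>n\<close>-th
  derivative.\<close>

lemma smooth_curve_coinduct:
  assumes "f \<in> K" and K: "\<And>g. g \<in> K \<Longrightarrow> \<exists>g'\<in>K. \<forall>t. (g has_vector_derivative g' t) (at t)"
  shows "smooth_curve f"
proof -
  have "(vderiv ^^ n) f \<in> K" for n
  proof (induction n)
    case (Suc n)
    then obtain g' where "g' \<in> K" "\<And>t. ((vderiv ^^ n) f has_vector_derivative g' t) (at t)"
      using K by blast
    moreover from this have "vderiv ((vderiv ^^ n) f) = g'" by (intro vderiv_eqI)
    ultimately show ?case by simp
  qed (use assms in simp)
  then show ?thesis unfolding smooth_curve_def
    using K by (meson differentiableI_vector)
qed

lemma smooth_curve_vderiv: "smooth_curve f \<Longrightarrow> smooth_curve (vderiv f)"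
  unfolding smooth_curve_def by (metis funpow_swap1 funpow.simps(2) o_apply)

lemma smooth_curve_funpow: "smooth_curve f \<Longrightarrow> smooth_curve ((vderiv ^^ n) f)"
  by (induction n) (auto intro: smooth_curve_vderiv)

lemma smooth_curve_has_vderiv: "smooth_curve f \<Longrightarrow> (f has_vector_derivative vderiv f t) (at t)"
  unfolding smooth_curve_def vderiv_def
  by (metis funpow_0 vector_derivative_works)

lemma smooth_curve_const: "smooth_curve (\<lambda>t. c)"
  by (rule smooth_curve_coinduct[of _ "range (\<lambda>c t. c)"])
     (auto intro!: exI[of _ 0] derivative_eq_intros)

text \<open>
  Sums of products are closed under differentiation, so coinduction applies to them but not to the
  products alone.
\<close>

inductive_set product_span :: "(real \<Rightarrow> complex) set" where
  mult: "smooth_curve f \<Longrightarrow> smooth_curve g \<Longrightarrow> (\<lambda>t. f t * g t) \<in> product_span"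
| add: "f \<in> product_span \<Longrightarrow> g \<in> product_span \<Longrightarrow> (\<lambda>t. f t + g t) \<in> product_span"

lemma smooth_curve_product_span:
  assumes "f \<in> product_span"
  shows "smooth_curve f"
proof (rule smooth_curve_coinduct[OF assms])
  fix g assume "g \<in> product_span"
  then show "\<exists>g'\<in>product_span. \<forall>t. (g has_vector_derivative g' t) (at t)"
  proof induction
    case (mult f g)
    have "((\<lambda>t. f t * g t) has_vector_derivative (f t * vderiv g t + vderiv f t * g t)) (at t)" for t
      using mult by (intro has_vector_derivative_mult smooth_curve_has_vderiv)
    moreover have "(\<lambda>t. f t * vderiv g t + vderiv f t * g t) \<in> product_span"
      using mult by (intro product_span.add product_span.mult smooth_curve_vderiv)
    ultimately show ?case by (intro bexI[of _ "\<lambda>t. f t * vderiv g t + vderiv f t * g t"] allI)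
  next
    case (add f g)
    then obtain f' g' where f': "f' \<in> product_span" "\<And>t. (f has_vector_derivative f' t) (at t)"
      and g': "g' \<in> product_span" "\<And>t. (g has_vector_derivative g' t) (at t)" by blast
    show ?case
      by (intro bexI[of _ "\<lambda>t. f' t + g' t"] allI has_vector_derivative_add product_span.add f' g')
  qed
qed

lemma smooth_curve_mult: "smooth_curve f \<Longrightarrow> smooth_curve g \<Longrightarrow> smooth_curve (\<lambda>t. f t * g t)"
  by (rule smooth_curve_product_span[OF product_span.mult])

lemma smooth_curve_add:
  assumes "smooth_curve f" "smooth_curve g" shows "smooth_curve (\<lambda>t. f t + g t)"
proof -
  have "(\<lambda>t. f t * 1 + g t * 1) \<in> product_span"
    using assms by (intro product_span.add product_span.mult smooth_curve_const)
  then show ?thesis using smooth_curve_product_span by simp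
qed

lemma smooth_curve_affine:
  assumes "smooth_curve f"
  shows "smooth_curve (\<lambda>t. f (c * t + d))"
proof (rule smooth_curve_coinduct[of _ "{\<lambda>t. f (c * t + d) |f. smooth_curve f}"])
  fix g assume "g \<in> {\<lambda>t. f (c * t + d) |f. smooth_curve f}"
  then obtain f where f: "smooth_curve f" "g = (\<lambda>t. f (c * t + d))" by blast
  have "(g has_vector_derivative of_real c * vderiv f (c * t + d)) (at t)" for t
  proof -
    have "((\<lambda>t. c * t + d) has_vector_derivative c) (at t)"
      by (auto intro!: derivative_eq_intros simp: has_real_derivative_iff_has_vector_derivative[symmetric])
    from vector_diff_chain_at[OF this smooth_curve_has_vderiv[OF f(1)]]
    show ?thesis by (simp add: f(2) o_def scaleR_conv_of_real)
  qed
  moreover have "smooth_curve (\<lambda>t. of_real c * vderiv f t)"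
    by (intro smooth_curve_mult smooth_curve_const smooth_curve_vderiv f)
  ultimately show "\<exists>g'\<in>{\<lambda>t. f (c * t + d) |f. smooth_curve f}. \<forall>t. (g has_vector_derivative g' t) (at t)"
    by (intro bexI[of _ "\<lambda>t. of_real c * vderiv f (c * t + d)"]) auto
qed (use assms in auto)

lemma has_vector_derivative_divide_power:
  fixes a q :: "real \<Rightarrow> complex"
  assumes "(a has_vector_derivative a') (at t)" "(q has_vector_derivative q') (at t)" "q t \<noteq> 0"
  shows "((\<lambda>t. a t / q t ^ n) has_vector_derivative
    (a' * q t + of_real (- real n) * (a t * q')) / q t ^ Suc n) (at t)"
proof (cases n)
  case 0
  then show ?thesis using assms by simp
next
  case (Suc k)
  have "0 < m \<Longrightarrow> q t * q t ^ (m - Suc 0) = q t ^ m" for m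
    by (cases m) auto
  then show ?thesis
    using assms unfolding has_vector_derivative_def Suc
    by (auto intro!: derivative_eq_intros simp: fun_eq_iff field_simps scaleR_conv_of_real)
qed

text \<open>The quotients \<open>a / q ^ n\<close> with smooth \<open>a\<close> form a class closed
  under differentiation: the quotient rule raises the exponent by one and yields another smooth
  numerator.\<close>

lemma smooth_curve_inverse:
  assumes q: "smooth_curve q" "\<And>t. q t \<noteq> 0"
  shows "smooth_curve (\<lambda>t. 1 / q t)"
proof (rule smooth_curve_coinduct[of _ "{\<lambda>t. a t / q t ^ n |a n. smooth_curve a}"])
  show "(\<lambda>t. 1 / q t) \<in> {\<lambda>t. a t / q t ^ n |a n. smooth_curve a}"
    using smooth_curve_const[of 1] by (auto intro!: exI[of _ "\<lambda>t. 1"] exI[of _ "1::nat"])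
  fix g assume "g \<in> {\<lambda>t. a t / q t ^ n |a n. smooth_curve a}"
  then obtain a n where a: "smooth_curve a" "g = (\<lambda>t. a t / q t ^ n)" by blast
  let ?b = "\<lambda>t. vderiv a t * q t + of_real (- real n) * (a t * vderiv q t)"
  have "(g has_vector_derivative ?b t / q t ^ Suc n) (at t)" for t
    unfolding a(2)
    by (rule has_vector_derivative_divide_power) (intro smooth_curve_has_vderiv a q)+
  moreover have "smooth_curve ?b"
    by (intro smooth_curve_add smooth_curve_mult smooth_curve_const smooth_curve_vderiv q a)
  ultimately show "\<exists>g'\<in>{\<lambda>t. a t / q t ^ n |a n. smooth_curve a}. \<forall>t. (g has_vector_derivative g' t) (at t)"
    by (intro bexI[of _ "\<lambda>t. ?b t / q t ^ Suc n"] allI) (auto intro!: exI[of _ ?b] exI[of _ "Suc n"] simp del: power_Suc)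
qed

text \<open>
  The functions \<open>x\<^sup>-\<^sup>k exp (-1/x)\<close>, extended by 0, span a space that is closed under differentiation.
\<close>

definition flat_exp :: "nat \<Rightarrow> real \<Rightarrow> real" where
  "flat_exp k x = (if x > 0 then (1 / x) ^ k * exp (- (1 / x)) else 0)"

lemma flat_exp_deriv:
  "(flat_exp k has_real_derivative (flat_exp (k + 2) x - real k * flat_exp (k + 1) x)) (at x)"
proof -
  consider "x > 0" | "x < 0" | "x = 0" by linarith
  then show ?thesis
  proof cases
    case 1
    have "((\<lambda>x. inverse x ^ k * exp (- inverse x)) has_real_derivative
       (inverse x ^ (k + 2) * exp (- inverse x) - real k * (inverse x ^ (k + 1) * exp (- inverse x)))) (at x)"
    proof (cases k)
      case 0
      then show ?thesis using 1 by (auto intro!: derivative_eq_intros simp: power2_eq_square)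
    next
      case (Suc j)
      show ?thesis unfolding Suc
        by (rule derivative_eq_intros refl | use 1 in \<open>simp add: algebra_simps power2_eq_square; fail\<close>)+
    qed
    moreover have "eventually (\<lambda>x. flat_exp k x = inverse x ^ k * exp (- inverse x)) (nhds x)"
      using eventually_nhds_in_open[of "{0<..}" x] 1 by (auto simp: flat_exp_def inverse_eq_divide elim!: eventually_mono)
    ultimately show ?thesis using 1
      by (subst DERIV_cong_ev[OF refl _ refl]) (auto simp: flat_exp_def inverse_eq_divide)
  next
    case 2
    have "eventually (\<lambda>x. flat_exp k x = 0) (nhds x)"
      using eventually_nhds_in_open[of "{..<0}" x] 2 by (auto simp: flat_exp_def elim!: eventually_mono)
    then show ?thesis using 2
      by (subst DERIV_cong_ev[OF refl _ refl]) (auto simp: flat_exp_def)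
  next
    case 3
    have "((\<lambda>h. flat_exp k h / h) \<longlongrightarrow> 0) (at_left 0)"
      by (rule tendsto_eventually) (auto simp: flat_exp_def eventually_at_left_field intro!: exI[of _ "-1"])
    moreover have "((\<lambda>h. flat_exp k h / h) \<longlongrightarrow> 0) (at_right 0)"
    proof -
      \<comment> \<open>With \<open>y = 1 / h\<close> the difference quotient at 0 from the right is
        \<open>y ^ (k + 1) / exp y\<close>, which tends to 0 as \<open>y\<close> grows.\<close>
      have "((\<lambda>h. inverse h ^ (k + 1) / exp (inverse h)) \<longlongrightarrow> 0) (at_right (0::real))"
        by (rule filterlim_compose[OF tendsto_power_div_exp_0 filterlim_inverse_at_top_right])
      then show ?thesis
        by (rule Lim_transform_eventually)
           (auto simp: flat_exp_def eventually_at_right_field field_simps exp_minus intro!: exI[of _ 1])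
    qed
    ultimately have "((\<lambda>h. flat_exp k h / h) \<longlongrightarrow> 0) (at 0)" by (simp add: filterlim_at_split)
    then show ?thesis by (simp add: 3 DERIV_def flat_exp_def)
  qed
qed

inductive_set flat_span :: "(real \<Rightarrow> complex) set" where
  base: "(\<lambda>x. complex_of_real (c * flat_exp k x)) \<in> flat_span"
| add: "f \<in> flat_span \<Longrightarrow> g \<in> flat_span \<Longrightarrow> (\<lambda>t. f t + g t) \<in> flat_span"

lemma smooth_curve_of_real_flat_exp: "smooth_curve (\<lambda>x. of_real (flat_exp k x))"
proof -
  have "(\<lambda>x. of_real (1 * flat_exp k x) + of_real (0 * flat_exp k x)) \<in> flat_span"
    by (intro flat_span.intros)
  then have "(\<lambda>x. of_real (flat_exp k x)) \<in> flat_span" by simp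
  then show ?thesis
  proof (rule smooth_curve_coinduct)
    fix g assume "g \<in> flat_span"
    then show "\<exists>g'\<in>flat_span. \<forall>t. (g has_vector_derivative g' t) (at t)"
    proof induction
      case (base c k)
      have "((\<lambda>x. of_real (c * flat_exp k x)) has_vector_derivative
         (complex_of_real (c * flat_exp (k + 2) t) + complex_of_real (- c * real k * flat_exp (k + 1) t))) (at t)" for t
      proof -
        have "((\<lambda>x. c * flat_exp k x) has_real_derivative c * (flat_exp (k + 2) t - real k * flat_exp (k + 1) t)) (at t)"
          by (rule DERIV_cmult[OF flat_exp_deriv])
        from has_vector_derivative_of_real[OF this, where 'a=complex] show ?thesis
          by (rule has_vector_derivative_eq_rhs) (simp add: algebra_simps)
      qed
      then show ?case
        by (intro bexI[OF _ flat_span.add[OF flat_span.base[of c "k + 2"] flat_span.base[of "- c * real k" "k + 1"]]] allI)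
    next
      case (add f g)
      then obtain f' g' where f': "f' \<in> flat_span" "\<And>t. (f has_vector_derivative f' t) (at t)"
        and g': "g' \<in> flat_span" "\<And>t. (g has_vector_derivative g' t) (at t)" by blast
      show ?case
        by (intro bexI[of _ "\<lambda>t. f' t + g' t"] allI has_vector_derivative_add flat_span.add f' g')
    qed
  qed
qed


text \<open>The classical smooth transition from 0 to 1 on [0,1]. The denominator is positive
  because \<open>t\<close> and \<open>1 - t\<close> are never both nonpositive.\<close>

definition smooth_step :: "real \<Rightarrow> real" where
  "smooth_step t = flat_exp 0 t / (flat_exp 0 t + flat_exp 0 (1 - t))"

lemma smooth_step_simps:
  "t \<le> 0 \<Longrightarrow> smooth_step t = 0" "1 \<le> t \<Longrightarrow> smooth_step t = 1"
  by (auto simp: smooth_step_def flat_exp_def)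

lemma smooth_step_bounds: "0 \<le> smooth_step t" "smooth_step t \<le> 1"
  by (auto simp: smooth_step_def flat_exp_def field_simps add_pos_pos less_imp_le)

lemma smooth_curve_smooth_step: "smooth_curve (\<lambda>t. of_real (smooth_step t))"
proof -
  have "smooth_curve (\<lambda>t. of_real (flat_exp 0 t) * (1 / (of_real (flat_exp 0 t) + of_real (flat_exp 0 (- 1 * t + 1)))))"
  proof (intro smooth_curve_mult smooth_curve_inverse smooth_curve_add smooth_curve_of_real_flat_exp)
    show "smooth_curve (\<lambda>t. of_real (flat_exp 0 (- 1 * t + 1)))"
      by (rule smooth_curve_affine[OF smooth_curve_of_real_flat_exp])
    show "complex_of_real (flat_exp 0 t) + of_real (flat_exp 0 (- 1 * t + 1)) \<noteq> 0" for t
    proof -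
      have "flat_exp 0 t + flat_exp 0 (- 1 * t + 1) > 0"
        by (auto simp: flat_exp_def add_pos_pos)
      then show ?thesis unfolding of_real_add[symmetric] of_real_eq_0_iff by linarith
    qed
  qed
  then show ?thesis by (simp add: smooth_step_def)
qed

text \<open>The two steps rise just before 0 and fall just after 1. The value is exactly 1 on the
  closed interval, so the cutoff contributes no derivatives inside it, and the support exceeds the
  interval by \<open>1 / Suc n\<close> on each side, which vanishes in the limit.\<close>

definition cutoff :: "nat \<Rightarrow> real \<Rightarrow> real" where
  "cutoff n t = smooth_step (real (Suc n) * t + 1) * smooth_step (- real (Suc n) * t + (real (Suc n) + 1))"

lemma cutoff_eq_1:
  assumes "t \<in> {0..1}"
  shows "cutoff n t = 1"
proof -
  have "0 \<le> real (Suc n) * t" "real (Suc n) * t \<le> real (Suc n)"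
    using assms by (auto intro!: mult_left_le simp del: of_nat_Suc)
  then have "1 \<le> real (Suc n) * t + 1" "1 \<le> - real (Suc n) * t + (real (Suc n) + 1)"
    unfolding mult_minus_left by linarith+
  then show ?thesis unfolding cutoff_def by (simp only: smooth_step_simps)
qed

lemma cutoff_eq_0:
  assumes "t \<le> - 1 / real (Suc n) \<or> t \<ge> 1 + 1 / real (Suc n)"
  shows "cutoff n t = 0"
proof -
  have "real (Suc n) * t + 1 \<le> 0 \<or> - real (Suc n) * t + (real (Suc n) + 1) \<le> 0"
    using assms by (auto simp: field_simps)
  then show ?thesis by (auto simp: cutoff_def smooth_step_simps)
qed

lemma cutoff_bounds: "0 \<le> cutoff n t" "cutoff n t \<le> 1"
  unfolding cutoff_def by (intro mult_nonneg_nonneg mult_le_one smooth_step_bounds)+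

lemma smooth_curve_cutoff: "smooth_curve (\<lambda>t. of_real (cutoff n t))"
proof -
  have "smooth_curve (\<lambda>t. of_real (smooth_step (real (Suc n) * t + 1)) *
     of_real (smooth_step (- real (Suc n) * t + (real (Suc n) + 1))))"
    by (intro smooth_curve_mult smooth_curve_affine[OF smooth_curve_smooth_step])
  then show ?thesis by (simp add: cutoff_def)
qed

lemma has_vector_derivative_cis:
  "((\<lambda>t. a * cis (c * t)) has_vector_derivative (\<i> * of_real c * (a * cis (c * t)))) (at t)"
proof -
  have "((\<lambda>z. a * exp (\<i> * (of_real c * z))) has_field_derivative
      \<i> * of_real c * (a * exp (\<i> * (of_real c * of_real t)))) (at (of_real t))"
    by (auto intro!: derivative_eq_intros)
  from has_vector_derivative_real_field[OF this] show ?thesis by (simp add: cis_conv_exp)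
qed

lemma vderiv_funpow_cis: "(vderiv ^^ n) (\<lambda>t. cis (c * t)) = (\<lambda>t. (\<i> * of_real c) ^ n * cis (c * t))"
proof (induction n)
  case (Suc n)
  show ?case
    by (simp add: Suc, rule vderiv_eqI[OF has_vector_derivative_eq_rhs[OF has_vector_derivative_cis]]) (simp add: mult.assoc)
qed simp

lemma smooth_curve_cis: "smooth_curve (\<lambda>t. cis (c * t))"
  unfolding smooth_curve_def vderiv_funpow_cis
  using has_vector_derivative_cis differentiableI_vector by blast

text \<open>Lets a cutoff be dropped, at every order of differentiation, on an open set where it is
  1.\<close>

lemma vderiv_funpow_cong_open:
  assumes "open S" "\<And>t. t \<in> S \<Longrightarrow> f t = g t" "t \<in> S"
  shows "(vderiv ^^ n) f t = (vderiv ^^ n) g t"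
  using assms(3)
proof (induction n arbitrary: t)
  case (Suc n)
  have "eventually (\<lambda>s. (vderiv ^^ n) f s = (vderiv ^^ n) g s) (nhds t)"
    using eventually_nhds_in_open[OF assms(1) Suc.prems] by eventually_elim (rule Suc.IH)
  then have "vector_derivative ((vderiv ^^ n) f) (at t) = vector_derivative ((vderiv ^^ n) g) (at t)"
    by (intro vector_derivative_cong_eq) simp_all
  then show ?case by (simp add: vderiv_def[of "(vderiv ^^ n) _"])
qed (use assms in simp)

text \<open>
  The real part turns a complex product of one-dimensional functions into a real test function; the
  factors \<open>c = 1\<close> and \<open>c = -\<i>\<close> recover the complex identity.
\<close>

definition product_fun :: "complex \<Rightarrow> ('d::finite \<Rightarrow> real \<Rightarrow> complex) \<Rightarrow> real^'d \<Rightarrow> real" where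
  "product_fun c w x = Re (c * (\<Prod>j\<in>UNIV. w j (x $ j)))"

lemma partial_deriv_product_fun:
  assumes w: "\<And>j. smooth_curve (w j)"
  shows "partial_deriv i (product_fun c w) = product_fun c (w(i := vderiv (w i)))"
proof
  fix x
  define P where "P = (\<Prod>j\<in>UNIV - {i}. w j (x $ j))"
  have split: "(\<Prod>j\<in>UNIV. u j (y $ j)) = u i (y $ i) * (\<Prod>j\<in>UNIV - {i}. u j (y $ j))" for u :: "'a \<Rightarrow> real \<Rightarrow> complex" and y
    by (rule prod.remove) auto
  have eq: "product_fun c w (x + t *\<^sub>R axis i 1) = Re (c * (w i (x $ i + t) * P))" for t
    unfolding product_fun_def split P_def
    by (intro arg_cong[where f=Re] arg_cong2[where f="(*)"] refl prod.cong) (auto simp: axis_def)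
  have "((\<lambda>t. x $ i + t) has_vector_derivative 1) (at 0)"
    by (auto intro!: derivative_eq_intros simp: has_real_derivative_iff_has_vector_derivative[symmetric])
  from vector_diff_chain_at[OF this smooth_curve_has_vderiv[OF w]]
  have "((\<lambda>t. w i (x $ i + t)) has_vector_derivative vderiv (w i) (x $ i)) (at 0)"
    by (simp add: o_def)
  then have "((\<lambda>t. c * (w i (x $ i + t) * P)) has_vector_derivative c * (vderiv (w i) (x $ i) * P)) (at 0)"
    by (intro has_vector_derivative_mult_right has_vector_derivative_mult_left)
  from bounded_linear.has_vector_derivative[OF bounded_linear_Re this]
  have "((\<lambda>t. product_fun c w (x + t *\<^sub>R axis i 1)) has_real_derivative Re (c * (vderiv (w i) (x $ i) * P))) (at 0)"
    unfolding eq has_real_derivative_iff_has_vector_derivative .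
  then have "partial_deriv i (product_fun c w) x = Re (c * (vderiv (w i) (x $ i) * P))"
    unfolding partial_deriv_def by (rule DERIV_imp_deriv)
  also have "\<dots> = product_fun c (w(i := vderiv (w i))) x"
    unfolding product_fun_def split P_def by simp
  finally show "partial_deriv i (product_fun c w) x = product_fun c (w(i := vderiv (w i))) x" .
qed

text \<open>A partial derivative acts on one factor only, so the iterates stay products and depend
  on \<open>js\<close> through its counts alone, which is how a multi-index enters
  \<open>has_weak_deriv\<close>.\<close>

lemma iter_partial_product_fun:
  assumes w: "\<And>j. smooth_curve (w j)"
  shows "iter_partial js (product_fun c w) = product_fun c (\<lambda>j. (vderiv ^^ count_list js j) (w j))"
proof (induction js)
  case (Cons i js)
  have "(\<lambda>j. (vderiv ^^ count_list js j) (w j))(i := vderiv ((vderiv ^^ count_list js i) (w i))) =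
      (\<lambda>j. (vderiv ^^ count_list (i # js) j) (w j))" by auto
  then show ?case
    by (simp only: iter_partial.simps Cons partial_deriv_product_fun[OF smooth_curve_funpow[OF w]])
qed simp

lemma smooth_curve_differentiable:
  assumes "smooth_curve f"
  shows "(\<lambda>x::real^'d. f (x $ j)) differentiable (at x)"
proof -
  have "f differentiable (at (x $ j))"
    using smooth_curve_has_vderiv[OF assms] by (rule differentiableI_vector)
  moreover have "(\<lambda>x::real^'d. x $ j) differentiable (at x)"
    by (simp add: bounded_linear_imp_differentiable bounded_linear_vec_nth)
  ultimately show ?thesis
    using differentiable_chain_at[of "\<lambda>x. x $ j" x f] by (simp add: o_def)
qed

lemma product_differentiable:
  assumes "\<And>j. smooth_curve (w j)"
  shows "(\<lambda>x::real^'d. \<Prod>j\<in>I. w j (x $ j)) differentiable (at x)"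
  by (induction I rule: infinite_finite_induct)
     (auto intro!: differentiable_mult smooth_curve_differentiable assms)

lemma test_function_product_fun:
  fixes w :: "'d::finite \<Rightarrow> real \<Rightarrow> complex"
  assumes w: "\<And>j. smooth_curve (w j)" and supp: "\<And>j t. \<bar>t\<bar> > R \<Longrightarrow> w j t = 0"
  shows "test_function (product_fun c w)"
  unfolding test_function_def
proof (intro conjI allI)
  fix js
  have "(\<lambda>x. c * (\<Prod>j\<in>UNIV. (vderiv ^^ count_list js j) (w j) (x $ j))) differentiable (at x)" for x
    by (intro differentiable_mult differentiable_const product_differentiable smooth_curve_funpow w)
  then have "(\<lambda>x. Re (c * (\<Prod>j\<in>UNIV. (vderiv ^^ count_list js j) (w j) (x $ j)))) differentiable (at x)" for x
    unfolding differentiable_def using bounded_linear.has_derivative[OF bounded_linear_Re] by fast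
  then show "iter_partial js (product_fun c w) differentiable_on UNIV"
    unfolding iter_partial_product_fun[OF w] differentiable_on_def unfolding product_fun_def[abs_def] by blast
next
  have "{x. product_fun c w x \<noteq> 0} \<subseteq> cbox (\<chi> i. - R) (\<chi> i. R)"
  proof
    fix x assume "x \<in> {x. product_fun c w x \<noteq> 0}"
    then have "c * (\<Prod>j\<in>UNIV. w j (x $ j)) \<noteq> 0" 
      unfolding product_fun_def mem_Collect_eq by (rule contrapos_nn) (simp only: zero_complex.sel)
    then have "w j (x $ j) \<noteq> 0" for j by simp
    then have "\<bar>x $ j\<bar> \<le> R" for j using supp by (meson not_le)
    then show "x \<in> cbox (\<chi> i. - R) (\<chi> i. R)" by (auto simp: mem_box_cart abs_le_iff minus_le_iff)
  qed
  then have "bounded {x. product_fun c w x \<noteq> 0}" by (rule bounded_subset[OF bounded_cbox])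
  then show "compact (closure {x. product_fun c w x \<noteq> 0})" by (simp add: compact_closure)
qed

section \<open>Fourier transform of weak derivatives\<close>

lemma ex_list_with_counts:
  fixes \<alpha> :: "nat^'d"
  shows "\<exists>js. \<forall>j. count_list js j = \<alpha> $ j"
proof -
  obtain js where js: "mset js = (\<Sum>j\<in>UNIV. replicate_mset (\<alpha> $ j) j)" using ex_mset by blast
  have "count_list js j = \<alpha> $ j" for j
    unfolding count_mset[symmetric] js count_sum by simp
  then show ?thesis by blast
qed

lemma prod_cis: "(\<Prod>j\<in>A. cis (f j)) = cis (\<Sum>j\<in>A. f j)"
  by (induction A rule: infinite_finite_induct) (simp_all add: cis_mult)

lemma has_weak_deriv_complex_test:
  fixes f g :: "real^'d \<Rightarrow> real"
  assumes wd: "has_weak_deriv \<alpha> f g" and w: "\<And>j. smooth_curve (w j)" and supp: "\<And>j t. \<bar>t\<bar> > R \<Longrightarrow> w j t = 0"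
    and intf: "integrable lborel (\<lambda>x. complex_of_real (f x) * (\<Prod>j\<in>UNIV. (vderiv ^^ (\<alpha> $ j)) (w j) (x $ j)))"
    and intg: "integrable lborel (\<lambda>x. complex_of_real (g x) * (\<Prod>j\<in>UNIV. w j (x $ j)))"
  shows "(LINT x|lborel. complex_of_real (f x) * (\<Prod>j\<in>UNIV. (vderiv ^^ (\<alpha> $ j)) (w j) (x $ j)))
    = (- 1) ^ (\<Sum>j\<in>UNIV. \<alpha> $ j) * (LINT x|lborel. complex_of_real (g x) * (\<Prod>j\<in>UNIV. w j (x $ j)))"
    (is "?I = ?s * ?J")
proof -
  obtain js where js: "\<And>j. count_list js j = \<alpha> $ j" using ex_list_with_counts by blast
  have eq: "(LINT x|lborel. f x * product_fun c (\<lambda>j. (vderiv ^^ (\<alpha> $ j)) (w j)) x) =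
     (- 1) ^ (\<Sum>j\<in>UNIV. \<alpha> $ j) * (LINT x|lborel. g x * product_fun c w x)" for c
  proof -
    have "test_function (product_fun c w)" by (rule test_function_product_fun[OF w supp])
    then have "(LINT x|lborel. f x * iter_partial js (product_fun c w) x) =
       (- 1) ^ (\<Sum>j\<in>UNIV. \<alpha> $ j) * (LINT x|lborel. g x * product_fun c w x)"
      using wd js unfolding has_weak_deriv_def by blast
    then show ?thesis by (simp only: iter_partial_product_fun[OF w] js)
  qed
  have re: "(LINT x|lborel. u x * product_fun c v x) = Re (c * (LINT x|lborel. complex_of_real (u x) * (\<Prod>j\<in>UNIV. v j (x $ j))))"
    if "integrable lborel (\<lambda>x. complex_of_real (u x) * (\<Prod>j\<in>UNIV. v j (x $ j)))" for u c v
  proof -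
    have "Re (c * (LINT x|lborel. complex_of_real (u x) * (\<Prod>j\<in>UNIV. v j (x $ j)))) =
       Re (LINT x|lborel. c * (complex_of_real (u x) * (\<Prod>j\<in>UNIV. v j (x $ j))))" by simp
    also have "\<dots> = (LINT x|lborel. Re (c * (complex_of_real (u x) * (\<Prod>j\<in>UNIV. v j (x $ j)))))"
      by (rule integral_Re[symmetric]) (use that in simp)
    also have "\<dots> = (LINT x|lborel. u x * product_fun c v x)"
      unfolding product_fun_def by (intro Bochner_Integration.integral_cong refl) (simp add: algebra_simps)
    finally show ?thesis by simp
  qed
  have "Re (c * ?I) = Re (c * (?s * ?J))" for c
  proof -
    have "Re (c * ?I) = (- 1) ^ (\<Sum>j\<in>UNIV. \<alpha> $ j) * Re (c * ?J)"
      using eq[of c] unfolding re[OF intf] re[OF intg] .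
    also have "\<dots> = Re (complex_of_real ((- 1) ^ (\<Sum>j\<in>UNIV. \<alpha> $ j)) * (c * ?J))"
      by (simp only: Re_complex_of_real Im_complex_of_real times_complex.sel)
    finally show ?thesis by (simp add: mult.left_commute)
  qed
  from this[of 1] this[of "- \<i>"] show ?thesis by (simp add: complex_eq_iff)
qed

text \<open>The test functions are conjugate characters times product cutoffs. The integral against
  \<open>f\<close> is the same for every \<open>n\<close>, while the one against \<open>g\<close>
  converges to the integral over the cube. Taking norms disposes of the sign and of the powers of
  the imaginary unit.\<close>

lemma torus_fourier_weak_deriv:
  fixes f g :: "real^'d \<Rightarrow> real"
  assumes wd: "has_weak_deriv \<alpha> f g" and cont: "continuous_on UNIV f" and supp: "\<And>x. x \<notin> cbox 0 1 \<Longrightarrow> f x = 0"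
    and [measurable]: "g \<in> borel_measurable borel"
  shows "norm (torus_fourier g \<xi>) = (\<Prod>j\<in>UNIV. (2 * pi * \<bar>\<xi> $ j\<bar>) ^ (\<alpha> $ j)) * norm (torus_fourier f \<xi>)"
proof -
  let ?e = "\<lambda>x. cnj (character \<xi> x)"
  have [measurable]: "f \<in> borel_measurable borel" using cont by (rule borel_measurable_continuous_onI)
  define w where "w n j t = of_real (cutoff n t) * cis ((- 2 * pi * \<xi> $ j) * t)" for n :: nat and j and t
  have w: "smooth_curve (w n j)" for n j
    unfolding w_def by (intro smooth_curve_mult smooth_curve_cutoff smooth_curve_cis)
  have wsupp: "w n j t = 0" if "\<bar>t\<bar> > 2" for n j t
  proof -
    have "1 / real (Suc n) \<le> 1" by simp
    then have "t \<le> - 1 / real (Suc n) \<or> t \<ge> 1 + 1 / real (Suc n)" using that by linarith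
    then show ?thesis by (simp add: w_def cutoff_eq_0)
  qed
  have e: "?e x = (\<Prod>j\<in>UNIV. cis ((- 2 * pi * \<xi> $ j) * x $ j))" for x
  proof -
    have "(\<Prod>j\<in>UNIV. cis ((- 2 * pi * \<xi> $ j) * x $ j)) = cis (\<Sum>j\<in>UNIV. (- 2 * pi * \<xi> $ j) * x $ j)"
      by (simp add: prod_cis)
    also have "(\<Sum>j\<in>UNIV. (- 2 * pi * \<xi> $ j) * x $ j) = - (2 * pi * (\<xi> \<bullet> x))"
      by (simp add: inner_vec_def sum_distrib_left sum_negf mult.assoc)
    finally show ?thesis by (simp add: character_def cis_cnj)
  qed
  define ct where "ct n x = (\<Prod>j\<in>UNIV. cutoff n (x $ j))" for n and x :: "real^'d"
  have prod_w: "(\<Prod>j\<in>UNIV. w n j (x $ j)) = of_real (ct n x) * ?e x" for n x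
    unfolding e w_def ct_def by (simp add: prod.distrib)
  \<comment> \<open>The factor that \<alpha>-fold differentiation of the conjugate character brings
    down; the minus sign comes from the conjugation.\<close>
  define Z where "Z = (\<Prod>j\<in>UNIV. (\<i> * of_real (- 2 * pi * \<xi> $ j)) ^ (\<alpha> $ j))"
  have prod_wd: "(\<Prod>j\<in>UNIV. (vderiv ^^ (\<alpha> $ j)) (w n j) (x $ j)) = Z * ?e x" if "x \<in> box 0 1" for n x
  proof -
    have "(vderiv ^^ (\<alpha> $ j)) (w n j) (x $ j) = (\<i> * of_real (- 2 * pi * \<xi> $ j)) ^ (\<alpha> $ j) * cis ((- 2 * pi * \<xi> $ j) * x $ j)" for j
    proof -
      have "(vderiv ^^ (\<alpha> $ j)) (w n j) (x $ j) = (vderiv ^^ (\<alpha> $ j)) (\<lambda>t. cis ((- 2 * pi * \<xi> $ j) * t)) (x $ j)"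
        by (rule vderiv_funpow_cong_open[of "{0<..<1}"]) (use that in \<open>auto simp: w_def cutoff_eq_1 mem_box_cart\<close>)
      then show ?thesis by (simp only: vderiv_funpow_cis)
    qed
    then show ?thesis unfolding Z_def e by (simp only: prod.distrib)
  qed
  have meas_wd: "(\<lambda>x::real^'d. \<Prod>j\<in>UNIV. (vderiv ^^ k j) (w n j) (x $ j)) \<in> borel_measurable borel" for n k
    by (intro borel_measurable_continuous_onI differentiable_imp_continuous_on)
       (auto simp: differentiable_on_def intro!: differentiable_at_withinI product_differentiable smooth_curve_funpow w)
  have ct01: "0 \<le> ct n x" "ct n x \<le> 1" for n x
    unfolding ct_def by (auto intro!: prod_nonneg prod_le_1 cutoff_bounds)
  have [measurable]: "ct n \<in> borel_measurable borel" for n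
  proof -
    have "ct n x = norm (\<Prod>j\<in>UNIV. w n j (x $ j))" for x
      unfolding prod_w using ct01(1)[of n x] by (simp add: norm_mult)
    then have "ct n = (\<lambda>x. norm (\<Prod>j\<in>UNIV. w n j (x $ j)))" by (simp add: fun_eq_iff)
    then show ?thesis using meas_wd[where k="\<lambda>_. 0"] by simp
  qed
  have "integrable lborel f"
    by (rule continuous_bounded_support_integrable[OF cont])
       (rule bounded_subset[OF bounded_cbox[of 0 1]], use supp in blast)
  then have intfe: "integrable lborel (\<lambda>x. Z * (complex_of_real (f x) * ?e x))"
    by (intro integrable_mult_right Bochner_Integration.integrable_bound[OF \<open>integrable lborel f\<close>]) (auto simp: norm_mult)
  \<comment> \<open>On the open cube the cutoffs are constant 1 and all derivatives fall on the
    exponential; off the closed cube \<open>f\<close> vanishes; the boundary in between is a null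
    set.\<close>
  have aef: "AE x in lborel. complex_of_real (f x) * (\<Prod>j\<in>UNIV. (vderiv ^^ (\<alpha> $ j)) (w n j) (x $ j)) = Z * (complex_of_real (f x) * ?e x)" for n
    using AE_open_cube_iff
  proof eventually_elim
    case (elim x)
    show ?case
    proof (cases "x \<in> cbox 0 1")
      case True
      with elim show ?thesis by (simp add: prod_wd)
    qed (simp add: supp)
  qed
  have intf: "integrable lborel (\<lambda>x. complex_of_real (f x) * (\<Prod>j\<in>UNIV. (vderiv ^^ (\<alpha> $ j)) (w n j) (x $ j)))" for n
    by (rule integrable_cong_AE[THEN iffD2, OF _ _ aef intfe]) (use meas_wd in measurable)
  \<comment> \<open>\<open>C\<close> contains the supports of all cutoffs because
    \<open>1 / Suc n\<close> is at most 1. Its compactness makes \<open>g\<close> integrable on it,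
    which gives a dominating function independent of \<open>n\<close>.\<close>
  define C where "C = cbox (\<chi> i. -2) (\<chi> i. 2 :: real^'d)"
  have intgC: "integrable lborel (\<lambda>x. indicator C x *\<^sub>R g x)"
  proof -
    have "locally_integrable g" using wd by (simp only: has_weak_deriv_def)
    moreover have "compact C" by (simp add: C_def)
    ultimately show ?thesis by (simp add: locally_integrable_def set_integrable_def)
  qed
  have bound: "norm (complex_of_real (g x) * (of_real (ct n x) * ?e x)) \<le> norm (indicator C x *\<^sub>R g x)" for n x
  proof (cases "x \<in> C")
    case True
    then show ?thesis using ct01[of n x] by (simp add: norm_mult mult_left_le)
  next
    case False
    then obtain j where "\<not> (- 2 \<le> x $ j \<and> x $ j \<le> 2)" by (auto simp: C_def mem_box_cart)
    then have "\<bar>x $ j\<bar> > 2" by linarith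
    then have "(\<Prod>j\<in>UNIV. w n j (x $ j)) = 0" using wsupp by (intro prod_zero) auto
    then have "complex_of_real (ct n x) * ?e x = 0" unfolding prod_w .
    then show ?thesis by (simp only: mult_zero_right norm_zero norm_ge_zero)
  qed
  have intg: "integrable lborel (\<lambda>x. complex_of_real (g x) * (\<Prod>j\<in>UNIV. w n j (x $ j)))" for n
    unfolding prod_w by (rule Bochner_Integration.integrable_bound[OF intgC]) (use bound in auto)
  have eq: "Z * torus_fourier f \<xi> = (- 1) ^ (\<Sum>j\<in>UNIV. \<alpha> $ j) * (LINT x|lborel. complex_of_real (g x) * (of_real (ct n x) * ?e x))" for n
  proof -
    have "Z * torus_fourier f \<xi> = Z * (LINT x|lborel. complex_of_real (f x) * ?e x)"
      by (subst integral_supported_cube) (use supp in auto)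
    also have "\<dots> = (LINT x|lborel. Z * (complex_of_real (f x) * ?e x))" by simp
    also have "\<dots> = (LINT x|lborel. complex_of_real (f x) * (\<Prod>j\<in>UNIV. (vderiv ^^ (\<alpha> $ j)) (w n j) (x $ j)))"
      by (rule integral_cong_AE[symmetric, OF _ _ aef]) (use meas_wd in measurable)
    finally show ?thesis
      using has_weak_deriv_complex_test[where w="w n" and R=2, OF wd w wsupp intf intg] unfolding prod_w by simp
  qed
  have "(\<lambda>n. LINT x|lborel. complex_of_real (g x) * (of_real (ct n x) * ?e x)) \<longlonglongrightarrow>
     (LINT x|lborel. complex_of_real (indicator (cbox 0 1) x *\<^sub>R g x) * ?e x)"
  proof (rule integral_dominated_convergence[where w="\<lambda>x. norm (indicator C x *\<^sub>R g x)"])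
    show "AE x in lborel. (\<lambda>n. complex_of_real (g x) * (of_real (ct n x) * ?e x)) \<longlonglongrightarrow>
       complex_of_real (indicator (cbox 0 1) x *\<^sub>R g x) * ?e x"
    proof (rule AE_I2)
      fix x :: "real^'d"
      \<comment> \<open>The convergence is eventual equality: a point outside the cube leaves it in
        some coordinate by a positive amount, and \<open>1 / Suc n\<close> eventually drops below
        that amount.\<close>
      have "eventually (\<lambda>n. ct n x = indicator (cbox 0 1) x) sequentially"
      proof (cases "x \<in> cbox 0 1")
        case True
        then show ?thesis by (simp add: ct_def cutoff_eq_1 mem_box_cart)
      next
        case False
        then obtain j where j: "x $ j < 0 \<or> x $ j > 1" by (auto simp: mem_box_cart not_le)
        have lim: "(\<lambda>n. 1 / real (Suc n)) \<longlonglongrightarrow> 0"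
          using LIMSEQ_inverse_real_of_nat by (simp add: inverse_eq_divide)
        have "eventually (\<lambda>n. 1 / real (Suc n) < max (- x $ j) (x $ j - 1)) sequentially"
          by (rule order_tendstoD(2)[OF lim]) (use j in auto)
        then show ?thesis
        proof eventually_elim
          case (elim n)
          then have "x $ j \<le> - 1 / real (Suc n) \<or> x $ j \<ge> 1 + 1 / real (Suc n)" by (auto simp: max_def split: if_splits)
          then have "cutoff n (x $ j) = 0" by (rule cutoff_eq_0)
          then have "ct n x = 0" unfolding ct_def by (intro prod_zero) auto
          then show ?case using False by simp
        qed
      qed
      then show "(\<lambda>n. complex_of_real (g x) * (of_real (ct n x) * ?e x)) \<longlonglongrightarrow>
         complex_of_real (indicator (cbox 0 1) x *\<^sub>R g x) * ?e x"
        by (intro tendsto_eventually) (auto elim!: eventually_mono simp: indicator_def)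
    qed
  qed (use intgC bound in auto)
  also have "(LINT x|lborel. complex_of_real (indicator (cbox 0 1) x *\<^sub>R g x) * ?e x) = torus_fourier g \<xi>"
    unfolding torus_fourier_def
    by (subst integral_torus)
       (use AE_unit_cell_iff in \<open>auto intro!: integral_cong_AE simp: indicator_def elim!: eventually_mono\<close>)
  finally have "(\<lambda>n. (- 1) ^ (\<Sum>j\<in>UNIV. \<alpha> $ j) * (LINT x|lborel. complex_of_real (g x) * (of_real (ct n x) * ?e x)))
      \<longlonglongrightarrow> (- 1) ^ (\<Sum>j\<in>UNIV. \<alpha> $ j) * torus_fourier g \<xi>"
    by (rule tendsto_mult_left)
  \<comment> \<open>By \<open>eq\<close> the sequence is constant, so its limit is its
    value.\<close>
  then have "Z * torus_fourier f \<xi> = (- 1) ^ (\<Sum>j\<in>UNIV. \<alpha> $ j) * torus_fourier g \<xi>"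
    unfolding eq[symmetric] by (rule LIMSEQ_unique[OF tendsto_const])
  then have "norm Z * norm (torus_fourier f \<xi>) = norm (torus_fourier g \<xi>)"
    by (metis norm_mult norm_power norm_minus_cancel norm_one power_one mult_1)
  moreover have "norm Z = (\<Prod>j\<in>UNIV. (2 * pi * \<bar>\<xi> $ j\<bar>) ^ (\<alpha> $ j))"
    by (simp add: Z_def prod_norm[symmetric] norm_power norm_mult abs_mult)
  ultimately show ?thesis by simp
qed

section \<open>Averaging over dilations of a Frolov lattice\<close>

lemma diag_mat_vector: "diag_mat u *v y = (\<chi> i. u $ i * y $ i)"
proof (rule vec_eq_iff[THEN iffD2], rule allI)
  fix i
  have "(diag_mat u *v y) $ i = (\<Sum>j\<in>UNIV. if j = i then u $ i * y $ i else 0)"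
    unfolding matrix_vector_mult_def diag_mat_def vec_lambda_beta by (intro sum.cong) auto
  then show "(diag_mat u *v y) $ i = (\<chi> i. u $ i * y $ i) $ i" by simp
qed

lemma det_diag_mat: "det (diag_mat u) = (\<Prod>i\<in>UNIV. u $ i)"
  by (subst det_diagonal) (simp_all add: diag_mat_def)

lemma diag_mat_mult: "diag_mat u ** diag_mat v = diag_mat (\<chi> i. u $ i * v $ i)"
proof (rule matrix_eq[THEN iffD2], rule allI)
  fix x
  show "(diag_mat u ** diag_mat v) *v x = diag_mat (\<chi> i. u $ i * v $ i) *v x"
    by (simp only: matrix_vector_mul_assoc[symmetric] diag_mat_vector vec_lambda_beta mult.assoc)
qed

lemma transpose_diag_mat: "transpose (diag_mat u) = diag_mat u"
  by (auto simp: transpose_def diag_mat_def vec_eq_iff)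

lemma diag_mat_scaleR: "diag_mat (s *\<^sub>R u) = s *\<^sub>R diag_mat u"
  by (simp add: diag_mat_def vec_eq_iff)

lemma diag_mat_one: "diag_mat (\<chi> i. 1) = mat 1"
  by (auto simp: diag_mat_def mat_def vec_eq_iff)

text \<open>Coordinatewise substitution \<open>x = y u\<close>. The constraint on \<open>u\<close>
  becomes one on the quotients \<open>x $ i / y $ i\<close>, so that for fixed \<open>x\<close> the
  lattice points satisfying it can be counted.\<close>

lemma nn_integral_stretch:
  fixes y :: "real^'d" and G :: "real^'d \<Rightarrow> ennreal"
  assumes [measurable]: "G \<in> borel_measurable borel" "C \<in> sets borel" and y: "\<And>i. y $ i \<noteq> 0"
  shows "(\<integral>\<^sup>+u. G (\<chi> i. y $ i * u $ i) * indicator C u \<partial>lborel) =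
    (\<integral>\<^sup>+x. G x * (ennreal (1 / \<bar>\<Prod>i\<in>UNIV. y $ i\<bar>) * indicator C (\<chi> i. x $ i / y $ i)) \<partial>lborel)"
proof -
  have [measurable]: "(\<lambda>u. \<chi> i. y $ i * u $ i) \<in> borel \<rightarrow>\<^sub>M (borel :: (real^'d) measure)"
    "(\<lambda>x. \<chi> i. x $ i / y $ i) \<in> borel \<rightarrow>\<^sub>M (borel :: (real^'d) measure)"
    by (rule borel_measurable_vec_lambda, measurable)+
  have inv: "(\<chi> i. (\<chi> i. y $ i * u $ i) $ i / y $ i) = u" for u :: "real^'d"
    using y by (simp add: vec_eq_iff)
  have p: "\<bar>\<Prod>i\<in>UNIV. y $ i\<bar> > 0" using y by simp
  let ?p = "ennreal \<bar>\<Prod>i\<in>UNIV. y $ i\<bar>" and ?q = "ennreal (1 / \<bar>\<Prod>i\<in>UNIV. y $ i\<bar>)"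
  have "?p * ?q = 1" using p by (subst ennreal_mult[symmetric]) auto
  then have eq: "?p * (a * (?q * b)) = a * b" for a b
    by (metis mult.assoc mult.left_commute mult_1)
  have "(\<integral>\<^sup>+x. G x * (?q * indicator C (\<chi> i. x $ i / y $ i)) \<partial>lborel) =
     (\<integral>\<^sup>+u. ?p * (G (\<chi> i. y $ i * u $ i) * (?q * indicator C (\<chi> i. (\<chi> i. y $ i * u $ i) $ i / y $ i))) \<partial>lborel)"
    by (subst lborel_stretch[of "\<lambda>i. y $ i", OF y])
       (simp add: nn_integral_density nn_integral_distr)
  then show ?thesis by (simp only: inv eq)
qed

section \<open>Lattice points reaching a given frequency\<close>

lemma frolov_scaled_prod:
  fixes B :: "real^'d^'d"
  assumes "frolov_matrix B" "k \<noteq> 0" and s: "s > 0"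
  shows "s ^ CARD('d) \<le> (\<Prod>j\<in>UNIV. \<bar>(s *\<^sub>R (B *v of_int_vec k)) $ j\<bar>)"
proof -
  have "1 \<le> \<bar>\<Prod>j\<in>UNIV. (B *v of_int_vec k) $ j\<bar>"
    using assms(1,2) by (simp add: frolov_matrix_def)
  then have "s ^ CARD('d) * 1 \<le> s ^ CARD('d) * (\<Prod>j\<in>UNIV. \<bar>(B *v of_int_vec k) $ j\<bar>)"
    using s by (intro mult_left_mono) (simp_all add: abs_prod)
  then show ?thesis using s by (simp add: abs_mult prod.distrib)
qed

text \<open>Let \<open>P\<close> be the absolute coordinate product of \<open>x\<close>. A point
  \<open>k\<close> contributes only if \<open>B k\<close> lies in a box of volume at most
  \<open>P / N\<close>, so there are at most \<open>P / N + 1\<close> such points. The dilations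
  multiply to at most \<open>t ^ d = 2\<close>, so each weight is at most \<open>2 / P\<close>. A
  contributing \<open>k\<close> also forces \<open>N\<close> to be at most \<open>P\<close>, by the
  Frolov bound on coordinate products, and then the total is at most \<open>4 / N\<close>.\<close>

lemma frolov_lattice_weight:
  fixes B :: "real^'d^'d" and x :: "real^'d"
  assumes B: "frolov_matrix B" and s: "s > 0" and t: "t \<ge> 1" "t ^ CARD('d) = 2"
  defines "y \<equiv> \<lambda>k. s *\<^sub>R (B *v of_int_vec k)"
  defines "N \<equiv> s ^ CARD('d)"
  shows "(\<integral>\<^sup>+k. ennreal (1 / \<bar>\<Prod>i\<in>UNIV. y k $ i\<bar>) * indicator (cbox 1 (\<chi> i. t)) (\<chi> i. x $ i / y k $ i) \<partial>count_space (UNIV - {0}))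
    \<le> ennreal (4 / N) * indicator {x. N \<le> (\<Prod>i\<in>UNIV. \<bar>x $ i\<bar>)} x" (is "?K \<le> _")
proof -
  define P where "P = (\<Prod>i\<in>UNIV. \<bar>x $ i\<bar>)"
  define M where "M = {k. k \<noteq> 0 \<and> (\<chi> i. x $ i / y k $ i) \<in> cbox 1 (\<chi> i. t)}"
  \<comment> \<open>\<open>x = u s B k\<close> coordinatewise with \<open>u\<close> between 1 and
    \<open>t\<close> places \<open>B k\<close> between \<open>x / (s t)\<close> and
    \<open>x / s\<close>; which corner is larger depends on the signs of \<open>x\<close>.\<close>
  define a b where "a = (1 / (s * t)) *\<^sub>R x" and "b = (1 / s) *\<^sub>R x"
  let ?L = "range (\<lambda>m. B *v of_int_vec m) \<inter> corner_box a b"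
  have N: "N > 0" using s by (simp add: N_def)
  have inj: "inj (\<lambda>m. B *v of_int_vec m)"
    using B inj_of_int_vec inj_matrix_vector_mult[of B]
    by (auto simp: frolov_matrix_def inj_on_def)
  have L: "finite ?L" "real (card ?L) \<le> (\<Prod>j\<in>UNIV. \<bar>a $ j - b $ j\<bar>) + 1"
    using B by (auto simp: frolov_matrix_def)
  \<comment> \<open>The true side lengths carry a factor \<open>1 - 1 / t\<close>, which is bounded
    by 1.\<close>
  have ab: "(\<Prod>j\<in>UNIV. \<bar>a $ j - b $ j\<bar>) \<le> P / N"
  proof -
    have "\<bar>a $ j - b $ j\<bar> \<le> \<bar>x $ j\<bar> / s" for j
    proof -
      have "b $ j - a $ j = (1 - 1 / t) * (x $ j / s)" using s t by (simp add: a_def b_def field_simps)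
      moreover have "0 \<le> 1 - 1 / t" "1 - 1 / t \<le> 1" using t by auto
      ultimately have "\<bar>b $ j - a $ j\<bar> = (1 - 1 / t) * \<bar>x $ j / s\<bar>" by (simp only: abs_mult abs_of_nonneg)
      also have "\<dots> \<le> 1 * \<bar>x $ j / s\<bar>" using \<open>1 - 1 / t \<le> 1\<close> by (rule mult_right_mono) simp
      finally have "\<bar>a $ j - b $ j\<bar> \<le> \<bar>x $ j / s\<bar>" by (simp add: abs_minus_commute)
      then show ?thesis using s by simp
    qed
    then have "(\<Prod>j\<in>UNIV. \<bar>a $ j - b $ j\<bar>) \<le> (\<Prod>j\<in>UNIV. \<bar>x $ j\<bar> / s)" by (intro prod_mono) auto
    then show ?thesis by (simp add: P_def N_def prod_dividef)
  qed
  have mem: "B *v of_int_vec k \<in> corner_box a b \<and> N \<le> P \<and> P \<le> 2 * \<bar>\<Prod>i\<in>UNIV. y k $ i\<bar> \<and> N \<le> \<bar>\<Prod>i\<in>UNIV. y k $ i\<bar>" if "k \<in> M" for k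
  proof -
    define u where "u i = x $ i / y k $ i" for i
    have k: "k \<noteq> 0" and u: "1 \<le> u i" "u i \<le> t" for i
      using that by (auto simp: M_def mem_box_cart u_def)
    have y0: "y k $ i \<noteq> 0" for i using u(1)[of i] by (auto simp: u_def)
    have x: "x $ i = u i * y k $ i" for i using y0 by (simp add: u_def)
    have NY: "N \<le> (\<Prod>i\<in>UNIV. \<bar>y k $ i\<bar>)"
      unfolding N_def y_def by (rule frolov_scaled_prod[OF B k s])
    have Pu: "P = (\<Prod>i\<in>UNIV. u i) * (\<Prod>i\<in>UNIV. \<bar>y k $ i\<bar>)"
      using u by (simp add: P_def x abs_mult prod.distrib abs_of_nonneg order_trans[OF zero_le_one])
    have "1 \<le> (\<Prod>i\<in>UNIV. u i)" by (intro prod_ge_1 u)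
    moreover have "(\<Prod>i\<in>UNIV. u i) \<le> 2"
    proof -
      have "(\<Prod>i\<in>UNIV. u i) \<le> (\<Prod>i\<in>(UNIV::'d set). t)"
        using u by (intro prod_mono) (auto intro: order_trans[OF zero_le_one])
      then show ?thesis using t by simp
    qed
    moreover have Y: "0 \<le> (\<Prod>i\<in>UNIV. \<bar>y k $ i\<bar>)" by (intro prod_nonneg) auto
    ultimately have "(\<Prod>i\<in>UNIV. \<bar>y k $ i\<bar>) \<le> P" "P \<le> 2 * (\<Prod>i\<in>UNIV. \<bar>y k $ i\<bar>)"
      unfolding Pu by (auto intro: mult_right_mono simp: mult_le_cancel_right1)
    moreover have "B *v of_int_vec k \<in> corner_box a b"
      unfolding corner_box_def
    proof (intro CollectI allI)
      fix j
      define z where "z = (B *v of_int_vec k) $ j"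
      have xz: "x $ j = u j * (s * z)" unfolding x y_def z_def by simp
      have az: "a $ j = (u j / t) * z" and bz: "b $ j = u j * z"
        using s t by (auto simp: a_def b_def xz)
      have "0 < u j" "u j / t \<le> 1" using u[of j] t by auto
      then show "min (a $ j) (b $ j) \<le> (B *v of_int_vec k) $ j \<and> (B *v of_int_vec k) $ j \<le> max (a $ j) (b $ j)"
        unfolding az bz z_def[symmetric] using u(1)[of j]
      proof (cases "0 \<le> z")
        case True
        then have "u j / t * z \<le> 1 * z" "1 * z \<le> u j * z"
          using \<open>u j / t \<le> 1\<close> u(1)[of j] by (intro mult_right_mono; simp)+
        then show "min (u j / t * z) (u j * z) \<le> z \<and> z \<le> max (u j / t * z) (u j * z)" by auto
      next
        case False
        then have "1 * z \<le> u j / t * z" "u j * z \<le> 1 * z"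
          using \<open>u j / t \<le> 1\<close> u(1)[of j] by (intro mult_right_mono_neg; simp)+
        then show "min (u j / t * z) (u j * z) \<le> z \<and> z \<le> max (u j / t * z) (u j * z)" by auto
      qed
    qed
    ultimately show ?thesis using NY by (auto simp: abs_prod)
  qed
  have imM: "(\<lambda>m. B *v of_int_vec m) ` M \<subseteq> ?L" using mem by blast
  have finM: "finite M"
    using finite_subset[OF imM L(1)] inj by (simp add: finite_image_iff inj_on_subset)
  have cardM: "real (card M) \<le> P / N + 1"
  proof -
    have "card M = card ((\<lambda>m. B *v of_int_vec m) ` M)"
      by (rule card_image[symmetric]) (rule inj_on_subset[OF inj], simp)
    also have "\<dots> \<le> card ?L" by (rule card_mono[OF L(1) imM])
    finally show ?thesis using L(2) ab by linarith
  qed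
  have "?K = (\<Sum>k\<in>M. ennreal (1 / \<bar>\<Prod>i\<in>UNIV. y k $ i\<bar>))"
  proof -
    have "?K = (\<Sum>k\<in>M. ennreal (1 / \<bar>\<Prod>i\<in>UNIV. y k $ i\<bar>) * indicator (cbox 1 (\<chi> i. t)) (\<chi> i. x $ i / y k $ i))"
      by (rule nn_integral_count_space'[OF finM]) (auto simp: M_def indicator_def)
    also have "\<dots> = (\<Sum>k\<in>M. ennreal (1 / \<bar>\<Prod>i\<in>UNIV. y k $ i\<bar>))"
      by (rule sum.cong) (auto simp: M_def indicator_def)
    finally show ?thesis .
  qed
  also have "\<dots> \<le> ennreal (4 / N) * indicator {x. N \<le> (\<Prod>i\<in>UNIV. \<bar>x $ i\<bar>)} x"
  proof (cases "M = {}")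
    case False
    then have NP: "N \<le> P" using mem by blast
    then have P0: "P > 0" using N by linarith
    have "(\<Sum>k\<in>M. 1 / \<bar>\<Prod>i\<in>UNIV. y k $ i\<bar>) \<le> (\<Sum>k\<in>M. 2 / P)"
    proof (rule sum_mono)
      fix k assume "k \<in> M"
      from mem[OF this] N have "P \<le> 2 * \<bar>\<Prod>i\<in>UNIV. y k $ i\<bar>" "\<bar>\<Prod>i\<in>UNIV. y k $ i\<bar> > 0" by linarith+
      then show "1 / \<bar>\<Prod>i\<in>UNIV. y k $ i\<bar> \<le> 2 / P" using P0 by (simp add: divide_simps mult.commute)
    qed
    also have "\<dots> = real (card M) * (2 / P)" by simp
    also have "\<dots> \<le> (P / N + 1) * (2 / P)" using cardM P0 by (intro mult_right_mono) auto
    \<comment> \<open>The first summand gives \<open>2 / N\<close>; the second gives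
      \<open>2 / P\<close>, which is at most \<open>2 / N\<close> because \<open>N\<close> is at
      most \<open>P\<close>.\<close>
    also have "\<dots> \<le> 4 / N" using NP N P0 by (simp add: field_simps)
    finally have "ennreal (\<Sum>k\<in>M. 1 / \<bar>\<Prod>i\<in>UNIV. y k $ i\<bar>) \<le> ennreal (4 / N)" by (rule ennreal_leI)
    moreover have "(\<Sum>k\<in>M. ennreal (1 / \<bar>\<Prod>i\<in>UNIV. y k $ i\<bar>)) = ennreal (\<Sum>k\<in>M. 1 / \<bar>\<Prod>i\<in>UNIV. y k $ i\<bar>)"
      by (rule sum_ennreal) simp
    ultimately show ?thesis using NP by (simp add: P_def)
  qed simp
  finally show ?thesis .
qed

text \<open>Tonelli twice: the sum over \<open>k\<close> is pulled out so that each term gets its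
  own substitution, and pulled back in so that the weights are added at fixed
  \<open>x\<close>.\<close>

lemma frolov_dilation_average:
  fixes B :: "real^'d^'d" and G :: "real^'d \<Rightarrow> ennreal"
  assumes B: "frolov_matrix B" and s: "s > 0" and t: "t \<ge> 1" "t ^ CARD('d) = 2"
    and [measurable]: "G \<in> borel_measurable borel"
  shows "(\<integral>\<^sup>+u. (\<integral>\<^sup>+k. G (diag_mat (s *\<^sub>R u) ** B *v of_int_vec k) \<partial>count_space (UNIV - {0})) * indicator (cbox 1 (\<chi> i. t)) u \<partial>lborel)
    \<le> ennreal (4 / s ^ CARD('d)) * (\<integral>\<^sup>+x. G x * indicator {x. s ^ CARD('d) \<le> (\<Prod>i\<in>UNIV. \<bar>x $ i\<bar>)} x \<partial>lborel)"
proof -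
  let ?C = "cbox 1 (\<chi> i. t) :: (real^'d) set" and ?I = "count_space (UNIV - {0 :: int^'d})"
  define y where "y k = s *\<^sub>R (B *v of_int_vec k)" for k
  have Su: "diag_mat (s *\<^sub>R u) ** B *v of_int_vec k = (\<chi> i. y k $ i * u $ i)" for u k
    by (simp add: matrix_vector_mul_assoc[symmetric] diag_mat_vector y_def mult_ac)
  have [measurable]: "(\<lambda>u. \<chi> i. z $ i * u $ i) \<in> borel \<rightarrow>\<^sub>M (borel :: (real^'d) measure)"
    "(\<lambda>x. \<chi> i. x $ i / z $ i) \<in> borel \<rightarrow>\<^sub>M (borel :: (real^'d) measure)" for z :: "real^'d"
    by (rule borel_measurable_vec_lambda, measurable)+
  \<comment> \<open>The Frolov product bound excludes zero coordinates, which the substitution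
    divides by.\<close>
  have y0: "y k $ i \<noteq> 0" if "k \<noteq> 0" for k i
  proof
    assume "y k $ i = 0"
    then have "(\<Prod>j\<in>UNIV. \<bar>y k $ j\<bar>) = 0" by (intro prod_zero) auto
    moreover have "s ^ CARD('d) > 0" using s by simp
    ultimately show False using frolov_scaled_prod[OF B that s] unfolding y_def[symmetric] by linarith
  qed
  have "(\<integral>\<^sup>+u. (\<integral>\<^sup>+k. G (diag_mat (s *\<^sub>R u) ** B *v of_int_vec k) \<partial>?I) * indicator ?C u \<partial>lborel)
     = (\<integral>\<^sup>+u. \<integral>\<^sup>+k. G (\<chi> i. y k $ i * u $ i) * indicator ?C u \<partial>?I \<partial>lborel)"
    unfolding Su by (intro nn_integral_cong) (subst nn_integral_multc, auto)
  also have "\<dots> = (\<integral>\<^sup>+k. \<integral>\<^sup>+u. G (\<chi> i. y k $ i * u $ i) * indicator ?C u \<partial>lborel \<partial>?I)"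
    by (rule nn_integral_count_space_nn_integral) auto
  also have "\<dots> = (\<integral>\<^sup>+k. \<integral>\<^sup>+x. G x * (ennreal (1 / \<bar>\<Prod>i\<in>UNIV. y k $ i\<bar>) * indicator ?C (\<chi> i. x $ i / y k $ i)) \<partial>lborel \<partial>?I)"
    by (intro nn_integral_cong nn_integral_stretch) (use y0 in auto)
  also have "\<dots> = (\<integral>\<^sup>+x. \<integral>\<^sup>+k. G x * (ennreal (1 / \<bar>\<Prod>i\<in>UNIV. y k $ i\<bar>) * indicator ?C (\<chi> i. x $ i / y k $ i)) \<partial>?I \<partial>lborel)"
    by (rule nn_integral_count_space_nn_integral[symmetric]) auto
  also have "\<dots> = (\<integral>\<^sup>+x. G x * (\<integral>\<^sup>+k. ennreal (1 / \<bar>\<Prod>i\<in>UNIV. y k $ i\<bar>) * indicator ?C (\<chi> i. x $ i / y k $ i) \<partial>?I) \<partial>lborel)"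
    by (intro nn_integral_cong nn_integral_cmult) auto
  also have "\<dots> \<le> (\<integral>\<^sup>+x. G x * (ennreal (4 / s ^ CARD('d)) * indicator {x. s ^ CARD('d) \<le> (\<Prod>i\<in>UNIV. \<bar>x $ i\<bar>)} x) \<partial>lborel)"
    unfolding y_def by (intro nn_integral_mono mult_left_mono frolov_lattice_weight[OF B s t]) auto
  also have "\<dots> = (\<integral>\<^sup>+x. ennreal (4 / s ^ CARD('d)) * (G x * indicator {x. s ^ CARD('d) \<le> (\<Prod>i\<in>UNIV. \<bar>x $ i\<bar>)} x) \<partial>lborel)"
    by (intro nn_integral_cong) (simp add: ac_simps)
  also have "\<dots> = ennreal (4 / s ^ CARD('d)) * (\<integral>\<^sup>+x. G x * indicator {x. s ^ CARD('d) \<le> (\<Prod>i\<in>UNIV. \<bar>x $ i\<bar>)} x \<partial>lborel)"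
    by (rule nn_integral_cmult) measurable
  finally show ?thesis .
qed

section \<open>The mean square error\<close>

text \<open>Makes the dependence of the nodes on \<open>u\<close> explicit as coordinatewise
  division; \<open>matrix_inv\<close> is defined by choice and by itself reveals nothing about
  measurability.\<close>

lemma matrix_inv_diag_mult:
  fixes B :: "real^'d^'d"
  assumes B: "invertible B" and u: "\<And>i. u $ i \<noteq> 0"
  shows "transpose (matrix_inv (diag_mat u ** B)) = diag_mat (\<chi> i. 1 / u $ i) ** transpose (matrix_inv B)"
    and "invertible (diag_mat u ** B)"
proof -
  let ?D = "diag_mat (\<chi> i. 1 / u $ i)"
  have BB: "matrix_inv B ** B = mat 1" using B by (rule matrix_inv_left)
  then have BB': "B ** matrix_inv B = mat 1" using matrix_left_right_inverse by blast
  have DD: "diag_mat u ** ?D = mat 1"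
    using u by (simp add: diag_mat_mult diag_mat_one[symmetric])
  have "diag_mat u ** B ** (matrix_inv B ** ?D) = diag_mat u ** (B ** matrix_inv B) ** ?D"
    by (simp only: matrix_mul_assoc)
  then have r: "diag_mat u ** B ** (matrix_inv B ** ?D) = mat 1"
    by (simp only: BB' matrix_mul_rid DD)
  then have l: "matrix_inv B ** ?D ** (diag_mat u ** B) = mat 1" using matrix_left_right_inverse by blast
  show inv: "invertible (diag_mat u ** B)" using r l unfolding invertible_def by blast
  have "matrix_inv (diag_mat u ** B) = matrix_inv (diag_mat u ** B) ** (diag_mat u ** B ** (matrix_inv B ** ?D))"
    by (simp only: r matrix_mul_rid)
  also have "\<dots> = matrix_inv B ** ?D"
    by (simp only: matrix_mul_assoc[of _ "diag_mat u ** B"] matrix_inv_left[OF inv] matrix_mul_lid)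
  finally show "transpose (matrix_inv (diag_mat u ** B)) = ?D ** transpose (matrix_inv B)"
    by (simp add: matrix_transpose_mul transpose_diag_mat)
qed

text \<open>Neither the infinite sum nor \<open>matrix_inv\<close> is visibly Borel in
  \<open>(u, v)\<close>, so the rule is written as a pointwise limit of finite sums over growing
  boxes of integer vectors. Bounded support makes these sums eventually constant.\<close>

lemma quadrature_measurable:
  fixes B :: "real^'d^'d" and f :: "real^'d \<Rightarrow> real"
  assumes B: "invertible B" and cont: "continuous_on UNIV f" and bdd: "bounded {x. f x \<noteq> 0}"
  shows "(\<lambda>(u, v). quadrature (diag_mat u ** B) v f) \<in> borel_measurable (borel \<Otimes>\<^sub>M borel)"
proof -
  have [measurable]: "f \<in> borel_measurable borel" using cont by (rule borel_measurable_continuous_onI)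
  define T where "T = transpose (matrix_inv B)"
  define A where "A k = {m::int^'d. \<forall>i. - int k \<le> m $ i \<and> m $ i \<le> int k}" for k
  \<comment> \<open>If some \<open>u $ i = 0\<close>, then \<open>det\<close> vanishes and both \<open>Q k u v\<close> and the quadrature are 0 since \<open>1 / 0 = 0\<close>.\<close>
  define Q where "Q k u v = 1 / \<bar>det (diag_mat u ** B)\<bar> *
    (\<Sum>m\<in>A k. f (\<chi> i. (T *v (of_int_vec m + v)) $ i / u $ i))" for k and u v :: "real^'d"
  have lim: "(\<lambda>k. Q k u v) \<longlonglongrightarrow> quadrature (diag_mat u ** B) v f" for u v
  proof (cases "\<forall>i. u $ i \<noteq> 0")
    case False
    then have "det (diag_mat u ** B) = 0" by (simp add: det_mul det_diag_mat)
    then show ?thesis by (simp add: Q_def quadrature_def)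
  next
    case True
    define \<phi> where "\<phi> x = f (transpose (matrix_inv (diag_mat u ** B)) *v x)" for x
    have \<phi>: "\<phi> x = f (\<chi> i. (T *v x) $ i / u $ i)" for x
      using True by (simp add: \<phi>_def matrix_inv_diag_mult(1)[OF B] matrix_vector_mul_assoc[symmetric]
          diag_mat_vector T_def)
    have inv: "invertible (diag_mat u ** B)" using True by (intro matrix_inv_diag_mult(2) B) blast
    have TA: "transpose (diag_mat u ** B) *v (transpose (matrix_inv (diag_mat u ** B)) *v x) = x" for x
      by (simp only: matrix_vector_mul_assoc matrix_transpose_mul[symmetric] matrix_inv_left[OF inv] transpose_mat matrix_vector_mul_lid)
    have "{x. \<phi> x \<noteq> 0} \<subseteq> (\<lambda>y. transpose (diag_mat u ** B) *v y) ` {x. f x \<noteq> 0}"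
    proof
      fix x assume "x \<in> {x. \<phi> x \<noteq> 0}"
      then show "x \<in> (\<lambda>y. transpose (diag_mat u ** B) *v y) ` {x. f x \<noteq> 0}"
        by (intro image_eqI[of _ _ "transpose (matrix_inv (diag_mat u ** B)) *v x"])
           (simp_all only: TA \<phi>_def mem_Collect_eq not_False_eq_True)
    qed
    then have "bounded {x. \<phi> x \<noteq> 0}"
      by (rule bounded_subset[rotated]) (intro bounded_linear_image matrix_vector_mul_bounded_linear bdd)
    then obtain F where F: "finite F" "\<And>w m. norm w \<le> norm v \<Longrightarrow> m \<notin> F \<Longrightarrow> \<phi> (of_int_vec m + w) = 0"
      using finite_lattice_translates by blast
    have quad: "quadrature (diag_mat u ** B) v f = 1 / \<bar>det (diag_mat u ** B)\<bar> * periodization \<phi> v"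
      by (simp add: quadrature_def periodization_def \<phi>_def)
    \<comment> \<open>A crude common bound for all coordinates of all points of
      \<open>F\<close>.\<close>
    define k0 where "k0 = (\<Sum>m\<in>F. \<Sum>i\<in>UNIV. nat \<bar>m $ i\<bar>)"
    have FA: "F \<subseteq> A k" if "k \<ge> k0" for k
    proof
      fix m assume m: "m \<in> F"
      have "nat \<bar>m $ i\<bar> \<le> k" for i
      proof -
        have "nat \<bar>m $ i\<bar> \<le> (\<Sum>i\<in>UNIV. nat \<bar>m $ i\<bar>)" by (rule member_le_sum) auto
        also have "\<dots> \<le> k0" unfolding k0_def by (rule member_le_sum[OF m]) (use F in auto)
        finally show ?thesis using that by simp
      qed
      then have "- int k \<le> m $ i \<and> m $ i \<le> int k" for i by (smt (verit) nat_le_iff)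
      then show "m \<in> A k" by (simp add: A_def)
    qed
    have "eventually (\<lambda>k. Q k u v = quadrature (diag_mat u ** B) v f) sequentially"
      using eventually_ge_at_top[of k0]
    proof eventually_elim
      case (elim k)
      have "finite (A k)" unfolding A_def by (rule finite_int_vec_box)
      then have "periodization \<phi> v = (\<Sum>m\<in>A k. \<phi> (of_int_vec m + v))"
        by (rule periodization_eq_sum) (use F(2)[of v] FA[OF elim] in blast)
      then show ?case unfolding quad Q_def \<phi> by simp
    qed
    then show ?thesis by (rule tendsto_eventually)
  qed
  have "(\<lambda>p. f (\<chi> i. (T *v (of_int_vec m + snd p)) $ i / fst p $ i)) \<in> borel_measurable (borel \<Otimes>\<^sub>M borel)" for m
  proof -
    have [measurable]: "(\<lambda>v. (T *v (of_int_vec m + v)) $ i) \<in> borel_measurable borel" for i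
      by (intro borel_measurable_continuous_onI continuous_on_component
          bounded_linear.continuous_on[OF matrix_vector_mul_bounded_linear] continuous_on_add
          continuous_on_const continuous_on_id)
    have [measurable]: "(\<lambda>p::(real^'d) \<times> (real^'d). \<chi> i. (T *v (of_int_vec m + snd p)) $ i / fst p $ i) \<in> borel_measurable (borel \<Otimes>\<^sub>M borel)"
      by (rule borel_measurable_vec_lambda) measurable
    show ?thesis by measurable
  qed
  then have "(\<lambda>p. Q k (fst p) (snd p)) \<in> borel_measurable (borel \<Otimes>\<^sub>M borel)" for k
    unfolding Q_def det_mul det_diag_mat by measurable
  then have "(\<lambda>p. quadrature (diag_mat (fst p) ** B) (snd p) f) \<in> borel_measurable (borel \<Otimes>\<^sub>M borel)"
    by (rule borel_measurable_LIMSEQ_metric) (rule lim)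
  then show ?thesis by (simp add: case_prod_beta)
qed

text \<open>Of the three factors, \<open>4 / s ^ d\<close> is the lattice weight, the square of
  \<open>1 / (s ^ d) ^ r\<close> comes from passing to the weak derivative where the coordinate
  product is at least \<open>s ^ d\<close>, and the last one comes from Bessel. Nonnegative
  integrals allow the bound before integrability of the error is known; the latter is deduced from
  it.\<close>

lemma mean_square_error_le:
  fixes B :: "real^'d^'d" and f g :: "real^'d \<Rightarrow> real"
  assumes B: "frolov_matrix B" and s: "s > 0" and t: "t > 1" "t ^ CARD('d) = 2"
    and cont: "continuous_on UNIV f" and supp: "\<And>x. x \<notin> cbox 0 1 \<Longrightarrow> f x = 0"
    and wd: "has_weak_deriv (\<chi> i. r) f g" and gm [measurable]: "g \<in> borel_measurable borel"
    and gi: "integrable torus (\<lambda>x. (g x)\<^sup>2)"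
  shows "(\<integral>\<^sup>+u. (\<integral>\<^sup>+v. ennreal ((quadrature (diag_mat (s *\<^sub>R u) ** B) v f - (LINT x|lborel. f x))\<^sup>2) \<partial>torus)
      * indicator (cbox 1 (\<chi> i. t)) u \<partial>lborel)
    \<le> ennreal (4 / s ^ CARD('d) * (1 / (s ^ CARD('d)) ^ r)\<^sup>2 * (LINT x|torus. (g x)\<^sup>2))"
proof -
  let ?N = "s ^ CARD('d)"
  let ?C = "cbox 1 (\<chi> i. t) :: (real^'d) set"
  have N: "?N > 0" using s by simp
  have iB: "invertible B" using B by (simp add: frolov_matrix_def)
  have [measurable]: "f \<in> borel_measurable borel" using cont by (rule borel_measurable_continuous_onI)
  define G where "G x = ennreal ((norm (torus_fourier f x))\<^sup>2)" for x
  have [measurable]: "G \<in> borel_measurable borel" unfolding G_def by measurable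
  have "(\<integral>\<^sup>+u. (\<integral>\<^sup>+v. ennreal ((quadrature (diag_mat (s *\<^sub>R u) ** B) v f - (LINT x|lborel. f x))\<^sup>2) \<partial>torus)
      * indicator ?C u \<partial>lborel)
    \<le> (\<integral>\<^sup>+u. (\<integral>\<^sup>+k. G (diag_mat (s *\<^sub>R u) ** B *v of_int_vec k) \<partial>count_space (UNIV - {0})) * indicator ?C u \<partial>lborel)"
  proof (rule nn_integral_mono)
    fix u :: "real^'d"
    show "(\<integral>\<^sup>+v. ennreal ((quadrature (diag_mat (s *\<^sub>R u) ** B) v f - (LINT x|lborel. f x))\<^sup>2) \<partial>torus) * indicator ?C u
      \<le> (\<integral>\<^sup>+k. G (diag_mat (s *\<^sub>R u) ** B *v of_int_vec k) \<partial>count_space (UNIV - {0})) * indicator ?C u"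
    proof (cases "u \<in> ?C")
      case True
      then have "(s *\<^sub>R u) $ i \<noteq> 0" for i
        using s by (auto simp: mem_box_cart) (metis not_one_le_zero)
      then have "invertible (diag_mat (s *\<^sub>R u) ** B)" by (rule matrix_inv_diag_mult(2)[OF iB])
      from quadrature_variance_le[OF this cont supp] show ?thesis
        unfolding G_def by (rule mult_right_mono) auto
    qed simp
  qed
  also have "\<dots> \<le> ennreal (4 / ?N) * (\<integral>\<^sup>+x. G x * indicator {x. ?N \<le> (\<Prod>i\<in>UNIV. \<bar>x $ i\<bar>)} x \<partial>lborel)"
    by (rule frolov_dilation_average[OF B s less_imp_le[OF t(1)] t(2)]) simp
  also have "(\<integral>\<^sup>+x. G x * indicator {x. ?N \<le> (\<Prod>i\<in>UNIV. \<bar>x $ i\<bar>)} x \<partial>lborel)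
     \<le> (\<integral>\<^sup>+x. ennreal ((1 / ?N ^ r)\<^sup>2) * ennreal ((norm (torus_fourier g x))\<^sup>2) \<partial>lborel)"
  proof (rule nn_integral_mono)
    fix x :: "real^'d"
    show "G x * indicator {x. ?N \<le> (\<Prod>i\<in>UNIV. \<bar>x $ i\<bar>)} x \<le>
        ennreal ((1 / ?N ^ r)\<^sup>2) * ennreal ((norm (torus_fourier g x))\<^sup>2)"
    proof (cases "?N \<le> (\<Prod>i\<in>UNIV. \<bar>x $ i\<bar>)")
      case True
      have "?N ^ r \<le> (\<Prod>i\<in>UNIV. \<bar>x $ i\<bar>) ^ r" using True N by (intro power_mono) auto
      also have "\<dots> = (\<Prod>i\<in>UNIV. \<bar>x $ i\<bar> ^ r)" by (simp add: prod_power_distrib)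
      \<comment> \<open>The factor \<open>2 * pi\<close> in each coordinate is at least 1 and is
        given away.\<close>
      also have "\<dots> \<le> (\<Prod>i\<in>UNIV. (2 * pi * \<bar>x $ i\<bar>) ^ r)"
      proof (intro prod_mono conjI power_mono)
        fix i
        have "1 * \<bar>x $ i\<bar> \<le> 2 * pi * \<bar>x $ i\<bar>" using pi_ge_two by (intro mult_right_mono) auto
        then show "\<bar>x $ i\<bar> \<le> 2 * pi * \<bar>x $ i\<bar>" by simp
      qed auto
      finally have "?N ^ r * norm (torus_fourier f x) \<le> norm (torus_fourier g x)"
        using torus_fourier_weak_deriv[OF wd cont supp gm, of x] by (simp add: mult_right_mono)
      then have "norm (torus_fourier f x) \<le> 1 / ?N ^ r * norm (torus_fourier g x)"
        using N by (simp add: field_simps)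
      then have "(norm (torus_fourier f x))\<^sup>2 \<le> (1 / ?N ^ r)\<^sup>2 * (norm (torus_fourier g x))\<^sup>2"
        unfolding power_mult_distrib[symmetric] by (rule power_mono) simp
      then show ?thesis unfolding G_def by (simp add: ennreal_mult[symmetric] indicator_def ennreal_leI)
    qed simp
  qed
  also have "\<dots> = ennreal ((1 / ?N ^ r)\<^sup>2) * (\<integral>\<^sup>+x. ennreal ((norm (torus_fourier g x))\<^sup>2) \<partial>lborel)"
    by (rule nn_integral_cmult) measurable
  also have "\<dots> \<le> ennreal ((1 / ?N ^ r)\<^sup>2) * ennreal (LINT x|torus. (g x)\<^sup>2)"
    by (intro mult_left_mono torus_fourier_square_le gi) auto
  finally show ?thesis using N
    by (simp add: mult_left_mono ennreal_mult[symmetric] mult.assoc)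
qed

lemma finite_mix_indices: "finite (mix_indices r :: (nat^'d) set)"
  using finite_vec_Pi[of "\<lambda>_. {..r}"] by (simp add: mix_indices_def)

lemma emeasure_lborel_cube:
  assumes "t > 1"
  shows "emeasure lborel (cbox 1 (\<chi> i. t) :: (real^'d) set) = ennreal ((t - 1) ^ CARD('d))"
proof -
  have "(\<Prod>b\<in>Basis. ((\<chi> i. t) - 1 :: real^'d) \<bullet> b) = (\<Prod>i\<in>(UNIV::'d set). t - 1)"
    by (simp add: Basis_vec_def UNION_singleton_eq_range prod.reindex axis_eq_axis inj_on_def inner_axis)
  then show ?thesis using assms
    by (subst emeasure_lborel_cbox) (auto simp: Basis_vec_def inner_axis)
qed

text \<open>Independence makes the joint law the product of the marginal laws, to which Tonelli
  applies.\<close>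

lemma (in prob_space) indep_nn_integral:
  assumes "indep_var S X T Y" and [measurable]: "h \<in> borel_measurable (S \<Otimes>\<^sub>M T)"
  shows "(\<integral>\<^sup>+\<omega>. h (X \<omega>, Y \<omega>) \<partial>M) = (\<integral>\<^sup>+u. \<integral>\<^sup>+v. h (u, v) \<partial>distr M T Y \<partial>distr M S X)"
proof -
  have X [measurable]: "X \<in> M \<rightarrow>\<^sub>M S" and Y [measurable]: "Y \<in> M \<rightarrow>\<^sub>M T"
    and eq: "distr M S X \<Otimes>\<^sub>M distr M T Y = distr M (S \<Otimes>\<^sub>M T) (\<lambda>\<omega>. (X \<omega>, Y \<omega>))"
    using assms(1) unfolding indep_var_distribution_eq by auto
  interpret Y: prob_space "distr M T Y" by (rule prob_space_distr[OF Y])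
  have "(\<integral>\<^sup>+\<omega>. h (X \<omega>, Y \<omega>) \<partial>M) = (\<integral>\<^sup>+p. h p \<partial>distr M (S \<Otimes>\<^sub>M T) (\<lambda>\<omega>. (X \<omega>, Y \<omega>)))"
    by (subst nn_integral_distr) auto
  also have "\<dots> = (\<integral>\<^sup>+u. \<integral>\<^sup>+v. h (u, v) \<partial>distr M T Y \<partial>distr M S X)"
    unfolding eq[symmetric] by (rule Y.nn_integral_fst[symmetric]) measurable
  finally show ?thesis .
qed

theorem theorem9:
  fixes r :: nat and B :: "real ^ 'd ^ 'd"
  assumes "r \<ge> 1" and "frolov_matrix B"
  shows "\<exists>c>0. \<forall>(M :: 'a measure) (U :: 'a \<Rightarrow> real ^ 'd) (V :: 'a \<Rightarrow> real ^ 'd).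
    prob_space M \<longrightarrow>
    prob_space.indep_var M borel U borel V \<longrightarrow>
    distr M borel U = uniform_measure lborel (cbox 1 (\<chi> i. 2 powr (1 / real CARD('d)))) \<longrightarrow>
    distr M borel V = uniform_measure lborel (cbox 0 1) \<longrightarrow>
    (\<forall>n::nat. n \<ge> 2 \<longrightarrow> (\<forall>f\<in>Hmix_unit_cube r.
      let err = (\<lambda>\<omega>. quadrature ((real n powr (1 / real CARD('d))) *\<^sub>R (diag_mat (U \<omega>) ** B)) (V \<omega>) f
                       - (LINT x|lborel. f x))
      in integrable M (\<lambda>\<omega>. \<bar>err \<omega>\<bar>\<^sup>2) \<and>
         sqrt (prob_space.expectation M (\<lambda>\<omega>. \<bar>err \<omega>\<bar>\<^sup>2))
           \<le> c * real n powr (- real r - 1 / 2) * Hmix_norm r f))"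
proof -
  let ?d = "CARD('d)"
  define t where "t = 2 powr (1 / real ?d)"
  have t: "t > 1" "t ^ ?d = 2"
    by (simp_all add: t_def powr_realpow[symmetric] powr_powr)
  define vol where "vol = (t - 1) ^ ?d"
  have vol: "vol > 0" using t by (simp add: vol_def)
  \<comment> \<open>The square of \<open>c\<close> is \<open>4 / vol\<close>: the 4 is that of the
    lattice weight, and \<open>1 / vol\<close> is the density of \<open>U\<close>.\<close>
  define c where "c = 2 / sqrt vol"
  have c: "c > 0" "c\<^sup>2 = 4 / vol" using vol by (simp_all add: c_def power_divide)
  let ?C = "cbox 1 (\<chi> i. t) :: (real^'d) set"
  have eC: "emeasure lborel ?C = ennreal vol" unfolding vol_def by (rule emeasure_lborel_cube[OF t(1)])
  show ?thesis
  proof (intro exI[of _ c] conjI c(1) allI impI ballI)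
    fix M :: "'a measure" and U V :: "'a \<Rightarrow> real ^ 'd" and n :: nat and f :: "real ^ 'd \<Rightarrow> real"
    assume "prob_space M" and indep: "prob_space.indep_var M borel U borel V"
      and dU: "distr M borel U = uniform_measure lborel (cbox 1 (\<chi> i. 2 powr (1 / real ?d)))"
      and dV: "distr M borel V = torus"
      and n: "n \<ge> 2" and f: "f \<in> Hmix_unit_cube r"
    interpret prob_space M by fact
    \<comment> \<open>Chosen so that \<open>s ^ CARD('d) = n\<close>, which makes \<open>n\<close>
      the lower bound on the coordinate products.\<close>
    define s where "s = real n powr (1 / real ?d)"
    have s: "s > 0" "s ^ ?d = real n"
      using n by (simp_all add: s_def powr_realpow[symmetric] powr_powr)
    have cont: "continuous_on UNIV f" using f by (simp add: Hmix_unit_cube_def Hmix_def)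
    have supp: "f x = 0" if "x \<notin> cbox 0 1" for x
    proof (rule ccontr)
      assume "f x \<noteq> 0"
      then have "x \<in> closure {x. f x \<noteq> 0}" using closure_subset[of "{x. f x \<noteq> 0}"] by (simp add: subset_iff)
      moreover have "closure {x. f x \<noteq> 0} \<subseteq> cbox 0 1" using f by (simp add: Hmix_unit_cube_def)
      ultimately show False using that by (simp add: subset_iff)
    qed
    define \<alpha> where "\<alpha> = (\<chi> i. r :: nat^'d)"
    \<comment> \<open>The very version of the derivative that \<open>Hmix_norm\<close> uses, so that
      its squared norm on the cube is one summand of the squared Sobolev norm.\<close>
    define g where "g = weak_deriv \<alpha> f"
    have \<alpha>: "\<alpha> \<in> mix_indices r" by (simp add: \<alpha>_def mix_indices_def)
    then have "\<exists>g. has_weak_deriv \<alpha> f g \<and> square_integrable g"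
      using f by (simp add: Hmix_unit_cube_def Hmix_def)
    then have g: "has_weak_deriv \<alpha> f g" "square_integrable g"
      unfolding g_def weak_deriv_def by (metis (mono_tags, lifting) someI_ex)+
    have gm [measurable]: "g \<in> borel_measurable borel" using g(2) by (simp add: square_integrable_def)
    have gi: "integrable torus (\<lambda>x. (g x)\<^sup>2)"
    proof (rule integrableI_bounded)
      have "(\<integral>\<^sup>+x. ennreal (norm ((g x)\<^sup>2)) \<partial>torus) \<le> (\<integral>\<^sup>+x. ennreal (norm ((g x)\<^sup>2)) \<partial>lborel)"
        by (subst nn_integral_torus) (auto intro!: nn_integral_mono simp: indicator_def)
      also have "\<dots> < \<infinity>" using g(2) by (simp add: square_integrable_def integrable_iff_bounded)
      finally show "(\<integral>\<^sup>+x. ennreal (norm ((g x)\<^sup>2)) \<partial>torus) < \<infinity>" .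
    qed measurable
    have gn: "(LINT x|torus. (g x)\<^sup>2) \<le> (Hmix_norm r f)\<^sup>2" and H0: "0 \<le> Hmix_norm r f"
    proof -
      let ?T = "\<lambda>\<alpha>. LINT x:cbox 0 1|lborel. (weak_deriv \<alpha> f x)\<^sup>2"
      have T0: "0 \<le> ?T \<beta>" for \<beta>
        unfolding set_lebesgue_integral_def by (rule Bochner_Integration.integral_nonneg) simp
      have "(LINT x|torus. (g x)\<^sup>2) = ?T \<alpha>"
        unfolding g_def[symmetric] set_lebesgue_integral_def
        by (subst integral_torus)
           (use AE_unit_cell_iff in \<open>auto intro!: integral_cong_AE simp: indicator_def elim!: eventually_mono\<close>)
      also have "\<dots> \<le> (\<Sum>\<alpha>\<in>mix_indices r. ?T \<alpha>)"
        by (rule member_le_sum[OF \<alpha>]) (use T0 finite_mix_indices in auto)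
      also have "\<dots> = (Hmix_norm r f)\<^sup>2"
        unfolding Hmix_norm_def by (subst real_sqrt_pow2) (auto intro!: sum_nonneg T0)
      finally show "(LINT x|torus. (g x)\<^sup>2) \<le> (Hmix_norm r f)\<^sup>2" .
      show "0 \<le> Hmix_norm r f"
        unfolding Hmix_norm_def by (intro real_sqrt_ge_zero sum_nonneg T0)
    qed
    define I where "I = (LINT x|lborel. f x)"
    define err where "err u v = quadrature (diag_mat (s *\<^sub>R u) ** B) v f - I" for u v
    have errU: "quadrature (s *\<^sub>R (diag_mat u ** B)) v f - (LINT x|lborel. f x) = err u v" for u v
    proof -
      have "s *\<^sub>R (diag_mat u ** B) = diag_mat (s *\<^sub>R u) ** B"
        by (simp add: scalar_matrix_assoc[symmetric] diag_mat_scaleR)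
      then show ?thesis by (simp add: err_def I_def)
    qed
    have em [measurable]: "(\<lambda>p. err (fst p) (snd p)) \<in> borel_measurable (borel \<Otimes>\<^sub>M borel)"
    proof -
      have "bounded {x. f x \<noteq> 0}"
        by (rule bounded_subset[OF bounded_cbox[of 0 1]]) (use supp in blast)
      from quadrature_measurable[OF _ cont this, of B] assms(2)
      have [measurable]: "(\<lambda>(u, v). quadrature (diag_mat u ** B) v f) \<in> borel_measurable (borel \<Otimes>\<^sub>M borel)"
        by (simp add: frolov_matrix_def)
      have "(\<lambda>p. (\<lambda>(u, v). quadrature (diag_mat u ** B) v f) (s *\<^sub>R fst p, snd p)) \<in> borel_measurable (borel \<Otimes>\<^sub>M borel)"
        by measurable
      then show ?thesis unfolding err_def by simp
    qed
    define K where "K = c\<^sup>2 * (real n powr (- real r - 1 / 2))\<^sup>2 * (LINT x|torus. (g x)\<^sup>2)"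
    have UV [measurable]: "U \<in> M \<rightarrow>\<^sub>M borel" "V \<in> M \<rightarrow>\<^sub>M borel"
      using indep unfolding indep_var_distribution_eq by auto
    have le: "(\<integral>\<^sup>+\<omega>. ennreal ((err (U \<omega>) (V \<omega>))\<^sup>2) \<partial>M) \<le> ennreal K"
    proof -
      have "(\<integral>\<^sup>+\<omega>. ennreal ((err (U \<omega>) (V \<omega>))\<^sup>2) \<partial>M) =
          (\<integral>\<^sup>+u. \<integral>\<^sup>+v. ennreal ((err u v)\<^sup>2) \<partial>torus \<partial>uniform_measure lborel ?C)"
        using indep_nn_integral[OF indep, of "\<lambda>p. ennreal ((err (fst p) (snd p))\<^sup>2)"]
        by (simp add: dU dV t_def)
      also have "\<dots> = (\<integral>\<^sup>+u. (\<integral>\<^sup>+v. ennreal ((err u v)\<^sup>2) \<partial>torus) * indicator ?C u \<partial>lborel) / ennreal vol"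
        unfolding eC[symmetric]
      proof (rule nn_integral_uniform_measure)
        have "(\<lambda>(u, v). ennreal ((err u v)\<^sup>2)) \<in> borel_measurable (lborel \<Otimes>\<^sub>M torus)"
          by (simp add: case_prod_beta) measurable
        then show "(\<lambda>u. \<integral>\<^sup>+v. ennreal ((err u v)\<^sup>2) \<partial>torus) \<in> borel_measurable lborel"
          by (rule sigma_finite_measure.borel_measurable_nn_integral[OF prob_space_imp_sigma_finite[OF prob_space_torus]])
      qed simp
      also have "\<dots> \<le> ennreal (4 / real n * (1 / real n ^ r)\<^sup>2 * (LINT x|torus. (g x)\<^sup>2)) / ennreal vol"
        unfolding err_def I_def
        using mean_square_error_le[OF assms(2) s(1) t cont supp g(1)[unfolded \<alpha>_def] gm gi]
        by (intro divide_right_mono_ennreal) (simp add: s(2))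
      also have "\<dots> = ennreal K"
      proof -
        \<comment> \<open>The square of the rate splits into \<open>n ^ (-2 r)\<close>, from the
          derivative, and \<open>1 / n\<close>, from the lattice weight.\<close>
        have "real n powr (- real r - 1 / 2) = real n powr (- real r) * real n powr (- (1 / 2))"
          by (simp add: powr_add[symmetric])
        then have "(real n powr (- real r - 1 / 2))\<^sup>2 = (real n powr (- real r))\<^sup>2 * (real n powr (- (1 / 2)) * real n powr (- (1 / 2)))"
          by (simp add: power2_eq_square)
        also have "real n powr (- (1 / 2)) * real n powr (- (1 / 2)) = 1 / real n"
          using n by (simp add: powr_add[symmetric] powr_minus_divide)
        also have "real n powr (- real r) = 1 / real n ^ r"
          using n by (simp add: powr_minus_divide powr_realpow)
        finally show ?thesis
          using vol by (simp add: K_def c(2) divide_ennreal)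
      qed
      finally show ?thesis .
    qed
    have em': "(\<lambda>\<omega>. err (U \<omega>) (V \<omega>)) \<in> borel_measurable M"
      using measurable_compose[OF measurable_Pair[OF UV] em] by simp
    \<comment> \<open>The finite bound gives integrability, which excludes that the expectation is
      merely the default value 0 of a divergent integral.\<close>
    have int: "integrable M (\<lambda>\<omega>. (err (U \<omega>) (V \<omega>))\<^sup>2)"
      by (rule integrableI_bounded) (use em' le in \<open>auto intro: le_less_trans\<close>)
    have "ennreal (expectation (\<lambda>\<omega>. (err (U \<omega>) (V \<omega>))\<^sup>2)) \<le> ennreal K"
      using le int by (subst (asm) nn_integral_eq_integral) auto
    moreover have K0: "0 \<le> K" unfolding K_def by (intro mult_nonneg_nonneg) auto
    ultimately have "expectation (\<lambda>\<omega>. (err (U \<omega>) (V \<omega>))\<^sup>2) \<le> K" by simp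
    also have "K \<le> (c * real n powr (- real r - 1 / 2) * Hmix_norm r f)\<^sup>2"
      unfolding K_def power_mult_distrib by (intro mult_left_mono gn) auto
    finally have "sqrt (expectation (\<lambda>\<omega>. (err (U \<omega>) (V \<omega>))\<^sup>2)) \<le> c * real n powr (- real r - 1 / 2) * Hmix_norm r f"
      using real_sqrt_le_mono c(1) H0 by fastforce
    with int show "let err = (\<lambda>\<omega>. quadrature ((real n powr (1 / real CARD('d))) *\<^sub>R (diag_mat (U \<omega>) ** B)) (V \<omega>) f
                       - (LINT x|lborel. f x))
      in integrable M (\<lambda>\<omega>. \<bar>err \<omega>\<bar>\<^sup>2) \<and>
         sqrt (prob_space.expectation M (\<lambda>\<omega>. \<bar>err \<omega>\<bar>\<^sup>2))
           \<le> c * real n powr (- real r - 1 / 2) * Hmix_norm r f"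
      unfolding Let_def s_def[symmetric] errU by simp
  qed
qed

end
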